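(* Let $\varepsilon$ be a primitive cube root of unity, let $b\in\mathbb C$ with $b^3=2$, and put $\tau=-\varepsilon\,\frac{b\varepsilon^2-1}{b\varepsilon-1}$. Then $$\mathbb P^1[6]\setminus\mathbb P^1[3]=\left\{\tau,\ (1-\tau)^{-1},\ 1-\tau^{-1},\ \tau^{-1},\ (1-\tau^{-1})^{-1},\ 1-\tau,\ -1,\ \tfrac12,\ 2\right\},$$ and the 36 Halphen cubics of order $2$ that are not Halphen cubics of order $1$ are the cubics $C_{t_u}$, $t\in\{v,h,\delta,\gamma\}$, $u\in\mathbb P^1[6]\setminus\mathbb P^1[3]$, given, up to nonzero scalar multiples, by the following polynomials. For $u=\tau$: $C_{v_u}=(b-\varepsilon)x^3+\varepsilon^2(b-1)y^3+(b\varepsilon-1)z^3$, $C_{h_u}=x^2y-\varepsilon^2bxy^2-\varepsilon^2bx^2z+y^2z+xz^2-\varepsilon^2byz^2$, $C_{\delta_u}=x^2y-bxy^2-\varepsilon^2bx^2z+\varepsilon^2y^2z+\varepsilon xz^2-\varepsilon byz^2$, $C_{\gamma_u}=x^2y-\varepsilon^2bxy^2-bx^2z+\varepsilon y^2z+\varepsilon^2xz^2-\varepsilon byz^2$. For $u=(1-\tau)^{-1}$: $C_{v_u}=\varepsilon(b\varepsilon-1)x^3+\varepsilon(b-\varepsilon)y^3+(b-1)z^3$, $C_{h_u}=x^2y-\varepsilon bxy^2-\varepsilon bx^2z+y^2z+xz^2-\varepsilon byz^2$, $C_{\delta_u}=x^2y-\varepsilon^2bxy^2-\varepsilon bx^2z+\varepsilon^2y^2z+\varepsilon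 xz^2-byz^2$, $C_{\gamma_u}=x^2y-\varepsilon bxy^2-\varepsilon^2bx^2z+\varepsilon y^2z+\varepsilon^2xz^2-byz^2$. For $u=1-\tau^{-1}$: $C_{v_u}=\varepsilon(b-1)x^3+(b-\varepsilon^2)y^3+(b\varepsilon^2-1)z^3$, $C_{h_u}=x^2y-bxy^2-bx^2z+y^2z+xz^2-byz^2$, $C_{\delta_u}=x^2y-\varepsilon bxy^2-bx^2z+\varepsilon^2y^2z+\varepsilon xz^2-\varepsilon^2byz^2$, $C_{\gamma_u}=x^2y-bxy^2-\varepsilon bx^2z+\varepsilon y^2z+\varepsilon^2xz^2-\varepsilon^2byz^2$. For $u=\tau^{-1}$: $C_{v_u}=(b-\varepsilon^2)x^3+\varepsilon(b-1)y^3+(b\varepsilon^2-1)z^3$, $C_{h_u}=2x^2y-\varepsilon^2b^2xy^2-\varepsilon^2b^2x^2z+2y^2z+2xz^2-\varepsilon^2b^2yz^2$, $C_{\delta_u}=2x^2y-b^2xy^2-\varepsilon^2b^2x^2z+2\varepsilon^2y^2z+2\varepsilon xz^2-\varepsilon b^2yz^2$, $C_{\gamma_u}=2x^2y-\varepsilon^2b^2xy^2-b^2x^2z+2\varepsilon y^2z+2\varepsilon^2xz^2-\varepsilon b^2yz^2$. For $u=(1-\tau^{-1})^{-1}$: $C_{v_u}=\varepsilon(b-\varepsilon)x^3+\varepsilon(b\varepsilon-1)y^3+(b-1)z^3$, $C_{h_u}=2x^2y-\varepsilon b^2xy^2-\varepsilon b^2x^2z+2y^2z+2xz^2-\varepsilon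 b^2yz^2$, $C_{\delta_u}=2x^2y-\varepsilon^2b^2xy^2-\varepsilon b^2x^2z+2\varepsilon^2y^2z+2\varepsilon xz^2-b^2yz^2$, $C_{\gamma_u}=2x^2y-\varepsilon b^2xy^2-\varepsilon^2b^2x^2z+2\varepsilon y^2z+2\varepsilon^2xz^2-b^2yz^2$. For $u=1-\tau$: $C_{v_u}=\varepsilon^2(b-1)x^3+(b-\varepsilon)y^3+(b\varepsilon-1)z^3$, $C_{h_u}=2x^2y-b^2xy^2-b^2x^2z+2y^2z+2xz^2-b^2yz^2$, $C_{\delta_u}=2x^2y-\varepsilon b^2xy^2-b^2x^2z+2\varepsilon^2y^2z+2\varepsilon xz^2-\varepsilon^2b^2yz^2$, $C_{\gamma_u}=2x^2y-b^2xy^2-\varepsilon b^2x^2z+2\varepsilon y^2z+2\varepsilon^2xz^2-\varepsilon^2b^2yz^2$. For $u=-1$: $C_{v_u}=x^3-2y^3+z^3$, $C_{h_u}=x^2y+\varepsilon^2xy^2+\varepsilon^2x^2z+y^2z+xz^2+\varepsilon^2yz^2$, $C_{\delta_u}=x^2y+xy^2+\varepsilon^2x^2z+\varepsilon^2y^2z+\varepsilon xz^2+\varepsilon yz^2$, $C_{\gamma_u}=x^2y+\varepsilon^2xy^2+x^2z+\varepsilon y^2z+\varepsilon^2xz^2+\varepsilon yz^2$. For $u=\frac12$: $C_{v_u}=x^3+y^3-2z^3$, $C_{h_u}=x^2y+\varepsilon xy^2+\varepsilon x^2z+y^2z+xz^2+\varepsilon yz^2$, $C_{\delta_u}=x^2y+\varepsilon^2xy^2+\varepsilon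 x^2z+\varepsilon^2y^2z+\varepsilon xz^2+yz^2$, $C_{\gamma_u}=x^2y+\varepsilon xy^2+\varepsilon^2x^2z+\varepsilon y^2z+\varepsilon^2xz^2+yz^2$. For $u=2$: $C_{v_u}=2x^3-y^3-z^3$, $C_{h_u}=x^2y+xy^2+x^2z+y^2z+xz^2+yz^2$, $C_{\delta_u}=x^2y+\varepsilon xy^2+x^2z+\varepsilon^2y^2z+\varepsilon xz^2+\varepsilon^2yz^2$, $C_{\gamma_u}=x^2y+xy^2+\varepsilon x^2z+\varepsilon y^2z+\varepsilon^2xz^2+\varepsilon^2yz^2$.
   Context: Work over $\mathbb C$; $\varepsilon$ is a primitive cube root of unity and $x,y,z$ are homogeneous coordinates on $\mathbb P^2$. Equianharmonic torsion parameters: let $M=\{0,1,\infty\}\subset\mathbb P^1$. There is an elliptic curve $T$ (necessarily of $j$-invariant $0$) and a degree $3$ morphism $f:T\to\mathbb P^1$ with triple ramification at three points and branch locus $M$. Take one of the ramification points as zero of the group law on $T$, let $T[3m]$ be the $3m$-torsion subgroup and put $\mathbb P^1[3m]=f(T[3m])\setminus M$. This set is independent of the choices and has $3m^2-1$ elements; it is invariant under the automorphisms of $\mathbb P^1$ preserving $M$. Pencils: there are four pencils of plane cubics $\mathcal C_t$, $t\in\{v,h,\delta,\gamma\}$, with members $C_{t_u}=C_{t_0}+u\,C_{t_\infty}$ ($u\in\mathbb C$) and $C_{t_\infty}$, where $C_{v_0}=z^3-y^3$, $C_{v_\infty}=y^3-x^3$; $C_{h_0}=(z-y)(z-x)(y-x)$,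 $C_{h_\infty}=(\varepsilon z-y)(z-\varepsilon x)(\varepsilon y-x)$; $C_{\delta_0}=(z-y)(\varepsilon z-x)(\varepsilon y-x)$, $C_{\delta_\infty}=(\varepsilon z-y)(z-x)(y-\varepsilon x)$; $C_{\gamma_0}=(\varepsilon z-y)(\varepsilon z-x)(y-x)$, $C_{\gamma_\infty}=(z-\varepsilon y)(z-x)(\varepsilon y-x)$. In each pencil the singular members are exactly those with $u\in\{0,1,\infty\}$, each a union of three concurrent lines. For $m\ge1$ the Halphen cubics of order $m$ are the cubics $C_{t_u}$ with $t\in\{v,h,\delta,\gamma\}$ and $u\in\mathbb P^1[3m]$. *)

theory Defs
  imports "HOL-Complex_Analysis.Complex_Analysis"
begin

section \<open>Elliptic curves and morphisms to the projective line\<close>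

text \<open>
  A complex elliptic curve is a complex torus \<open>\<complex>/\<Lambda>\<close>.  A morphism from it to the
  projective line is a \<open>\<Lambda>\<close>-periodic meromorphic function on the plane; the predicate
  \<open>nicely_meromorphic_on\<close> excludes removable singularities with a wrong value, so that
  a point is mapped to infinity exactly if it is a pole.
  The projective line is \<^typ>\<open>complex option\<close>, with \<^const>\<open>None\<close> as the point at infinity.
\<close>

type_synonym proj_line = "complex option"

definition is_lattice :: "complex set \<Rightarrow> bool" where
  "is_lattice \<Lambda> \<longleftrightarrow> (\<exists>w1 w2. w1 \<noteq> 0 \<and> w2 / w1 \<notin> \<real> \<and>
     \<Lambda> = {of_int m * w1 + of_int n * w2 | m n. True})"

definition torus_point :: "complex set \<Rightarrow> complex \<Rightarrow> complex set" where
  "torus_point \<Lambda> z = (\<lambda>w. z + w) ` \<Lambda>"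

definition torus_morphism :: "complex set \<Rightarrow> (complex \<Rightarrow> complex) \<Rightarrow> bool" where
  "torus_morphism \<Lambda> f \<longleftrightarrow>
     f nicely_meromorphic_on UNIV \<and> (\<forall>z. \<forall>w\<in>\<Lambda>. f (z + w) = f z)"

definition proj_value :: "(complex \<Rightarrow> complex) \<Rightarrow> complex \<Rightarrow> proj_line" where
  "proj_value f z = (if is_pole f z then None else Some (f z))"

text \<open>Meaningful for a nonconstant meromorphic function only.\<close>

definition ram_index :: "(complex \<Rightarrow> complex) \<Rightarrow> complex \<Rightarrow> nat" where
  "ram_index f z =
     nat (if is_pole f z then - zorder f z else zorder (\<lambda>w. f w - f z) z)"

text \<open>
  The degree is the number of points of a fibre, counted with ramification indices.  The
  ramification index is constant on each class \<open>z + \<Lambda>\<close>, hence the use of \<^const>\<open>the_elem\<close>.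
\<close>

definition torus_fibre ::
  "complex set \<Rightarrow> (complex \<Rightarrow> complex) \<Rightarrow> proj_line \<Rightarrow> complex set set" where
  "torus_fibre \<Lambda> f q = torus_point \<Lambda> ` {z. proj_value f z = q}"

definition has_torus_degree ::
  "complex set \<Rightarrow> (complex \<Rightarrow> complex) \<Rightarrow> nat \<Rightarrow> bool" where
  "has_torus_degree \<Lambda> f d \<longleftrightarrow> \<not> f constant_on UNIV \<and>
     (\<forall>q. finite (torus_fibre \<Lambda> f q) \<and>
          (\<Sum>P\<in>torus_fibre \<Lambda> f q. the_elem (ram_index f ` P)) = d)"

definition special_points :: "proj_line set" where
  "special_points = {Some 0, Some 1, None}"

definition equianharmonic_cover :: "complex set \<Rightarrow> (complex \<Rightarrow> complex) \<Rightarrow> bool" where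
  "equianharmonic_cover \<Lambda> f \<longleftrightarrow>
     is_lattice \<Lambda> \<and> torus_morphism \<Lambda> f \<and> has_torus_degree \<Lambda> f 3 \<and>
     card (torus_point \<Lambda> ` {z. ram_index f z = 3}) = 3 \<and>
     proj_value f ` {z. ram_index f z > 1} = special_points"

text \<open>
  If the class of \<open>p\<close> is the zero of the group law, then the \<open>n\<close>-th multiple of the class of
  \<open>z\<close> is the class of \<open>p + n (z - p)\<close>.
\<close>

definition torsion_reps :: "complex set \<Rightarrow> complex \<Rightarrow> nat \<Rightarrow> complex set" where
  "torsion_reps \<Lambda> p n = {z. of_nat n * (z - p) \<in> \<Lambda>}"

definition proj_torsion ::
  "complex set \<Rightarrow> (complex \<Rightarrow> complex) \<Rightarrow> complex \<Rightarrow> nat \<Rightarrow> proj_line set" where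
  "proj_torsion \<Lambda> f p n = proj_value f ` torsion_reps \<Lambda> p n - special_points"


section \<open>Plane cubics and the four pencils\<close>

text \<open>
  Over the complex numbers a form in three variables may be identified with the function it
  defines.  A plane curve is a form up to nonzero scalars.
\<close>

type_synonym ternary_form = "complex \<Rightarrow> complex \<Rightarrow> complex \<Rightarrow> complex"

definition proportional :: "ternary_form \<Rightarrow> ternary_form \<Rightarrow> bool" where
  "proportional F G \<longleftrightarrow> (\<exists>c. c \<noteq> 0 \<and> (\<forall>x y z. F x y z = c * G x y z))"

definition plane_curve :: "ternary_form \<Rightarrow> ternary_form set" where
  "plane_curve F = {G. proportional G F}"

datatype pencil = Pencil_v | Pencil_h | Pencil_delta | Pencil_gamma

fun pencil_zero :: "complex \<Rightarrow> pencil \<Rightarrow> ternary_form" where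
  "pencil_zero \<epsilon> Pencil_v x y z = z^3 - y^3"
| "pencil_zero \<epsilon> Pencil_h x y z = (z - y) * (z - x) * (y - x)"
| "pencil_zero \<epsilon> Pencil_delta x y z = (z - y) * (\<epsilon> * z - x) * (\<epsilon> * y - x)"
| "pencil_zero \<epsilon> Pencil_gamma x y z = (\<epsilon> * z - y) * (\<epsilon> * z - x) * (y - x)"

fun pencil_infinity :: "complex \<Rightarrow> pencil \<Rightarrow> ternary_form" where
  "pencil_infinity \<epsilon> Pencil_v x y z = y^3 - x^3"
| "pencil_infinity \<epsilon> Pencil_h x y z = (\<epsilon> * z - y) * (z - \<epsilon> * x) * (\<epsilon> * y - x)"
| "pencil_infinity \<epsilon> Pencil_delta x y z = (\<epsilon> * z - y) * (z - x) * (y - \<epsilon> * x)"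
| "pencil_infinity \<epsilon> Pencil_gamma x y z = (z - \<epsilon> * y) * (z - x) * (\<epsilon> * y - x)"

fun pencil_member :: "complex \<Rightarrow> pencil \<Rightarrow> proj_line \<Rightarrow> ternary_form" where
  "pencil_member \<epsilon> t (Some u) x y z = pencil_zero \<epsilon> t x y z + u * pencil_infinity \<epsilon> t x y z"
| "pencil_member \<epsilon> t None x y z = pencil_infinity \<epsilon> t x y z"

definition halphen_cubics ::
  "complex \<Rightarrow> complex set \<Rightarrow> (complex \<Rightarrow> complex) \<Rightarrow> complex \<Rightarrow> nat \<Rightarrow> ternary_form set set" where
  "halphen_cubics \<epsilon> \<Lambda> f p m =
     {plane_curve (pencil_member \<epsilon> t u) | t u. u \<in> proj_torsion \<Lambda> f p (3 * m)}"

end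

theory Submission
  imports Defs
begin

text \<open>
  Let \<open>q\<close> be the point over infinity and take it as the zero of the group law.  Comparing zeros and poles,
  Liouville's theorem gives \<open>f'^3 = c * f^2 * (f - 1)^2\<close> with a constant \<open>c\<close>.  A solution of this equation
  is determined by having a pole at \<open>q\<close>.  Since \<open>f(\<epsilon> z)\<close>, \<open>1 - f(- z)\<close> and, up to replacing \<open>c\<close> by \<open>8 * c\<close>,
  also \<open>f(2 z)\<close> and \<open>R(f(z))\<close> with \<open>R(u) = (u + 1)^3 * (u - 1) / (2 * u - 1)^3\<close> solve it, one obtains
  \<open>f(\<epsilon> z) = f(z)\<close>, \<open>f(- z) = 1 - f(z)\<close> and \<open>f(2 z) = R(f(z))\<close>.

  Hence \<open>3 z = 0\<close> means \<open>f(2 z) = f(- z)\<close>, that is \<open>R(u) = 1 - u\<close> for \<open>u = f(z)\<close>, and \<open>6 z = 0\<close> means that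
  \<open>R(u)\<close> is one of the values at \<open>3\<close>-torsion points.  The other two ramification points are \<open>3\<close>-torsion
  points, so the choice of the zero among the three does not matter.
\<close>

section \<open>Periodic meromorphic functions\<close>

text \<open>The cover is known only through its degree and ramification: neither
  \<open>\<Lambda>\<close> nor \<open>f\<close> is explicit, and \<open>c\<close> is not normalized.
  So the symmetry of the lattice and the duplication formula cannot be read off a model; both are
  consequences of uniqueness for the differential equation. That such formulas must exist is clear
  geometrically: \<open>f\<close> is the quotient of the torus by the rotations by powers of
  \<open>\<epsilon>\<close>, and negation and doubling commute with rotations, so they descend to
  rational maps of degree 1 and 4 on the projective line. \<open>R\<close> is the second of these.
  An equation that is cubic in the derivative usually leaves a choice of cube root. Here the pole
  removes it: the leading coefficient of a solution with a pole is determined by \<open>c\<close>.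
  All identities between meromorphic functions are obtained on punctured neighbourhoods only,
  because quotients take default values where a denominator vanishes. Limits then turn them into
  identities between points of the projective line, valid at every point of the torus.\<close>

lemma lattice_group:
  assumes "is_lattice \<Lambda>"
  shows lattice_zero: "0 \<in> \<Lambda>"
    and lattice_add: "\<And>x y. x \<in> \<Lambda> \<Longrightarrow> y \<in> \<Lambda> \<Longrightarrow> x + y \<in> \<Lambda>"
    and lattice_minus: "\<And>x. x \<in> \<Lambda> \<Longrightarrow> - x \<in> \<Lambda>"
proof -
  obtain w1 w2 where L: "\<Lambda> = {of_int m * w1 + of_int n * w2 | m n. True}"
    using assms unfolding is_lattice_def by auto
  show "0 \<in> \<Lambda>" unfolding L by (auto intro!: exI[of _ 0])
  show "x + y \<in> \<Lambda>" if xy: "x \<in> \<Lambda>" "y \<in> \<Lambda>" for x y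
  proof -
    obtain a b c d where "x = of_int a * w1 + of_int b * w2" "y = of_int c * w1 + of_int d * w2"
      using xy unfolding L by auto
    hence "x + y = of_int (a + c) * w1 + of_int (b + d) * w2" by (simp add: algebra_simps)
    thus ?thesis unfolding L by blast
  qed
  show "- x \<in> \<Lambda>" if x: "x \<in> \<Lambda>" for x
  proof -
    obtain a b where "x = of_int a * w1 + of_int b * w2" using x unfolding L by auto
    hence "- x = of_int (- a) * w1 + of_int (- b) * w2" by (simp add: algebra_simps)
    thus ?thesis unfolding L by blast
  qed
qed

text \<open>\<open>K\<close> is the closed period parallelogram. The real coordinates of
  \<open>z\<close> with respect to \<open>w1\<close>, \<open>w2\<close> come from the imaginary and
  real parts of \<open>z / w1\<close> and are reduced to their fractional parts.\<close>

lemma lattice_compact_representatives: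
  assumes "is_lattice \<Lambda>"
  obtains K where "compact K" "\<And>z. \<exists>w\<in>\<Lambda>. z + w \<in> K"
proof -
  obtain w1 w2 where w: "w1 \<noteq> 0" "w2 / w1 \<notin> \<real>"
    and L: "\<Lambda> = {of_int m * w1 + of_int n * w2 | m n. True}"
    using assms unfolding is_lattice_def by auto
  define q where "q = w2 / w1"
  have q: "Im q \<noteq> 0" "w2 = q * w1" using w by (auto simp: q_def complex_is_Real_iff)
  define K where "K = (\<lambda>(s::real, t::real). of_real s * w1 + of_real t * w2) ` ({0..1} \<times> {0..1})"
  have "compact K" unfolding K_def
    by (intro compact_continuous_image compact_Times compact_Icc)
       (auto simp: case_prod_unfold intro!: continuous_intros)
  moreover have "\<exists>w\<in>\<Lambda>. z + w \<in> K" for z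
  proof -
    define t where "t = Im (z / w1) / Im q"
    define s where "s = Re (z / w1) - t * Re q"
    have "z / w1 = of_real s + of_real t * q"
      using q by (intro complex_eqI) (auto simp: s_def t_def)
    hence z: "z = of_real s * w1 + of_real t * w2" using w q by (simp add: field_simps)
    define w where "w = of_int (- \<lfloor>s\<rfloor>) * w1 + of_int (- \<lfloor>t\<rfloor>) * w2"
    have "w \<in> \<Lambda>" unfolding L w_def by blast
    moreover have "z + w = of_real (frac s) * w1 + of_real (frac t) * w2"
      unfolding z w_def frac_def by (simp add: algebra_simps)
    hence "z + w \<in> K" unfolding K_def
      by (auto intro!: image_eqI[of _ _ "(frac s, frac t)"] simp: frac_lt_1 less_imp_le)
    ultimately show ?thesis by blast
  qed
  ultimately show ?thesis using that by blast
qed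

text \<open>Liouville's theorem applies to \<open>remove_sings G\<close>, which is entire and takes
  all its values on a compact set. \<open>G\<close> itself may have wrong values at isolated points,
  hence the conclusion on punctured neighbourhoods.\<close>

lemma periodic_without_poles_is_constant:
  assumes L: "is_lattice \<Lambda>" and G: "G meromorphic_on UNIV"
    and per: "\<And>z w. w \<in> \<Lambda> \<Longrightarrow> G (z + w) = G z"
    and np: "\<And>z. \<not> is_pole G z"
  obtains c where "\<And>z. eventually (\<lambda>x. G x = c) (at z)"
proof -
  define h where "h = remove_sings G"
  have Gz: "G meromorphic_on {z}" for z using G meromorphic_on_subset by blast
  have iso: "isolated_singularity_at G z" for z
    using Gz meromorphic_on_isolated_singularity by blast
  have "h nicely_meromorphic_on UNIV"
    unfolding h_def using G by (rule remove_sings_nicely_meromorphic)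
  moreover have "\<not> is_pole h z" for z
    using np iso by (simp add: h_def)
  ultimately have "h analytic_on UNIV"
    using nicely_meromorphic_without_singularities by blast
  hence hol: "h holomorphic_on UNIV" by (rule analytic_imp_holomorphic)
  have hper: "h (z + w) = h z" if "w \<in> \<Lambda>" for z w
  proof -
    have "h (z + w) = remove_sings (\<lambda>u. G (z + w + u)) 0"
      unfolding h_def by (subst remove_sings_shift_0) (rule refl)
    also have "(\<lambda>u. G (z + w + u)) = (\<lambda>u. G (z + u))"
      using per[OF that] by (metis add.assoc add.commute)
    also have "remove_sings \<dots> 0 = h z"
      unfolding h_def by (subst remove_sings_shift_0[of G z]) (rule refl)
    finally show ?thesis .
  qed
  obtain K where K: "compact K" "\<And>z. \<exists>w\<in>\<Lambda>. z + w \<in> K"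
    using lattice_compact_representatives[OF L] by blast
  have "bounded (h ` K)"
    using K(1) hol
    by (intro compact_imp_bounded compact_continuous_image)
       (auto intro: holomorphic_on_imp_continuous_on holomorphic_on_subset)
  moreover have "range h \<subseteq> h ` K"
  proof safe
    fix z
    obtain w where w: "w \<in> \<Lambda>" "z + w \<in> K" using K(2) by blast
    thus "h z \<in> h ` K" using hper by (metis image_eqI)
  qed
  ultimately have "bounded (range h)" using bounded_subset by blast
  with hol have "h constant_on UNIV" by (rule Liouville_theorem)
  then obtain c where c: "\<And>z. h z = c" unfolding constant_on_def by blast
  have "eventually (\<lambda>x. G x = c) (at z)" for z
    using eventually_remove_sings_eq_at[OF iso, of z] c by (simp add: h_def eq_commute)
  thus ?thesis using that by blast
qed

text \<open>The alternatives are the expansions at a triple pole, a triple zero, a triple point over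
  1 and a point over any other value. In the first three the order is - 12 + 6 + 6, 6 - 6 - 0 and 6
  - 0 - 6, each equal to 0.\<close>

lemma cubic_quotient_subdegree:
  fixes F :: "complex fls"
  assumes "fls_subdegree F = - 3 \<or> fls_subdegree F = 3 \<or> fls_subdegree (F - 1) = 3 \<or>
    F \<noteq> 0 \<and> F \<noteq> 1 \<and> fls_subdegree F = 0 \<and> fls_subdegree (F - 1) = 0"
  shows "0 \<le> fls_subdegree (fls_deriv F ^ 3 / (F ^ 2 * (F - 1) ^ 2))"
proof -
  have ord: "fls_subdegree (fls_deriv F ^ 3 / (F ^ 2 * (F - 1) ^ 2)) =
    3 * fls_subdegree (fls_deriv F) - 2 * fls_subdegree F - 2 * fls_subdegree (F - 1)"
    if "fls_deriv F \<noteq> 0" "F \<noteq> 0" "F - 1 \<noteq> 0"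
    using that by (simp add: fls_divide_subdegree fls_subdegree_pow)
  consider "fls_subdegree F = - 3" | "fls_subdegree F = 3" | "fls_subdegree (F - 1) = 3"
    | "F \<noteq> 0 \<and> F \<noteq> 1 \<and> fls_subdegree F = 0 \<and> fls_subdegree (F - 1) = 0"
    using assms by blast
  thus ?thesis
  proof cases
    case 1
    hence "F \<noteq> 0" by auto
    have "fls_subdegree (F - 1) = - 3"
      using 1 by (subst fls_subdegree_diff_eq1) auto
    moreover have "fls_subdegree (fls_deriv F) = - 4"
      using 1 by (subst fls_subdegree_deriv) auto
    ultimately show ?thesis using 1 by (subst ord) auto
  next
    case 2
    have "fls_subdegree (F - 1) = 0"
      using 2 by (subst fls_subdegree_diff_eq2) auto
    moreover have "fls_subdegree (fls_deriv F) = 2"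
      using 2 by (subst fls_subdegree_deriv) auto
    moreover have "F - 1 \<noteq> 0" using 2 by auto
    ultimately show ?thesis using 2 by (subst ord) auto
  next
    case 3
    have "fls_subdegree ((F - 1) + 1) = 0"
      using 3 by (subst fls_subdegree_add_eq2) auto
    moreover have "fls_subdegree (fls_deriv (F - 1)) = 2"
      using 3 by (subst fls_subdegree_deriv) auto
    moreover have "F \<noteq> 0" using 3 by auto
    ultimately show ?thesis using 3 by (subst ord) auto
  next
    case 4
    show ?thesis
    proof (cases "fls_deriv F = 0")
      case False
      have "fls_subdegree (fls_deriv F) \<ge> 0"
        using 4 fls_deriv_subdegree0 by blast
      thus ?thesis using 4 by (subst ord) (use False in auto)
    qed auto
  qed
qed

section \<open>The differential equation\<close>

text \<open>
  \<open>F\<close> stands for \<open>z^3 * f(z)\<close>, where \<open>f'^3 = c * f^2 * (f - 1)^2\<close> and \<open>f\<close> has a triple pole at \<open>0\<close>.  The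
  equation fixes the leading coefficient; comparing the first coefficient, of index \<open>n\<close>, in which two
  solutions differ gives \<open>27 * (n - 3) = - 108\<close>, so \<open>n = - 1\<close>.
\<close>

lemma fps_solution_unique:
  fixes F G :: "complex fps" and c :: complex
  assumes c: "c \<noteq> 0"
    and F: "(fps_X * fps_deriv F - 3 * F) ^ 3 = fps_const c * F ^ 2 * (F - fps_X ^ 3) ^ 2"
    and G: "(fps_X * fps_deriv G - 3 * G) ^ 3 = fps_const c * G ^ 2 * (G - fps_X ^ 3) ^ 2"
    and nz: "fps_nth F 0 \<noteq> 0" "fps_nth G 0 \<noteq> 0"
  shows "F = G"
proof (rule ccontr)
  assume "F \<noteq> G"
  have lead: "c * fps_nth H 0 = - 27"
    if "(fps_X * fps_deriv H - 3 * H) ^ 3 = fps_const c * H ^ 2 * (H - fps_X ^ 3) ^ 2"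
      "fps_nth H 0 \<noteq> 0" for H
  proof -
    define h where "h = fps_nth H 0"
    have "fps_nth ((fps_X * fps_deriv H - 3 * H) ^ 3) 0 = fps_nth (fps_const c * H ^ 2 * (H - fps_X ^ 3) ^ 2) 0"
      using that(1) by simp
    hence "(- 3 * h) ^ 3 = c * h ^ 2 * h ^ 2"
      by (simp add: fps_nth_power_0 h_def)
    hence "(c * h + 27) * h ^ 3 = 0" by (simp add: power_mult_distrib) algebra
    thus ?thesis using that(2) by (simp add: h_def add_eq_0_iff2)
  qed
  define a where "a = fps_nth F 0"
  have ca: "c * a = - 27" and aG: "fps_nth G 0 = a" and "a \<noteq> 0"
    using lead[OF F nz(1)] lead[OF G nz(2)] c nz by (auto simp: a_def) (metis mult_cancel_left)
  define n where "n = subdegree (F - G)"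
  define E where "E = fps_shift n (F - G)"
  have FG: "F - G = fps_X ^ n * E"
    using subdegree_decompose[of "F - G"] by (simp add: E_def n_def mult.commute)
  have e: "fps_nth E 0 \<noteq> 0" using nth_subdegree_nonzero[of "F - G"] \<open>F \<noteq> G\<close>
    by (simp add: E_def n_def)
  define DF where "DF = fps_X * fps_deriv F - 3 * F"
  define DG where "DG = fps_X * fps_deriv G - 3 * G"
  have "fps_X * fps_deriv (fps_X ^ n :: complex fps) = of_nat n * fps_X ^ n"
    by (induction n) (simp_all add: algebra_simps)
  hence "fps_X * fps_deriv (fps_X ^ n * E) = fps_X ^ n * (of_nat n * E + fps_X * fps_deriv E)"
    by (simp add: algebra_simps)
  hence D: "DF - DG = fps_X ^ n * (of_nat n * E + fps_X * fps_deriv E - 3 * E)"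
    using FG unfolding DF_def DG_def by (simp add: algebra_simps flip: FG)
  \<comment> \<open>Factoring a difference of cubes on one side and of squares on the other exposes
    \<open>F - G\<close> on both, so that \<open>fps_X ^ n\<close> can be cancelled.\<close>
  have "(DF - DG) * (DF ^ 2 + DF * DG + DG ^ 2) = DF ^ 3 - DG ^ 3"
    by (simp add: algebra_simps power2_eq_square power3_eq_cube)
  also have "\<dots> = fps_const c * (F - G) * (F + G - fps_X ^ 3) * (F * (F - fps_X ^ 3) + G * (G - fps_X ^ 3))"
    unfolding DF_def DG_def F G by (simp add: algebra_simps power2_eq_square)
  finally have "fps_X ^ n * ((of_nat n * E + fps_X * fps_deriv E - 3 * E) * (DF ^ 2 + DF * DG + DG ^ 2))
      = fps_X ^ n * (fps_const c * E * (F + G - fps_X ^ 3) * (F * (F - fps_X ^ 3) + G * (G - fps_X ^ 3)))"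
    unfolding D FG by (simp add: mult_ac)
  hence "(of_nat n * E + fps_X * fps_deriv E - 3 * E) * (DF ^ 2 + DF * DG + DG ^ 2)
      = fps_const c * E * (F + G - fps_X ^ 3) * (F * (F - fps_X ^ 3) + G * (G - fps_X ^ 3))"
    by simp
  hence "fps_nth ((of_nat n * E + fps_X * fps_deriv E - 3 * E) * (DF ^ 2 + DF * DG + DG ^ 2)) 0
      = fps_nth (fps_const c * E * (F + G - fps_X ^ 3) * (F * (F - fps_X ^ 3) + G * (G - fps_X ^ 3))) 0"
    by simp
  \<comment> \<open>\<open>DF\<close> and \<open>DG\<close> both have constant term - 3 a. Up to the
    constant term of \<open>E\<close>, the left side is (n - 3) * 27 a^2 and the right side is c * 2
    a * 2 a^2; a^2 is cancelled.\<close>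
  hence "of_nat n * (fps_nth E 0 * 27) = a * (c * (fps_nth E 0 * 4)) + fps_nth E 0 * 81"
    using \<open>a \<noteq> 0\<close>
    by (simp add: DF_def DG_def aG fps_nth_power_0 power2_eq_square flip: a_def)
       (simp add: algebra_simps)
  hence "fps_nth E 0 * ((of_nat n - 3) * 27 - 4 * (c * a)) = 0" by algebra
  hence "(of_nat n - 3) * 27 = (- 108 :: complex)"
    using e unfolding ca by simp
  \<comment> \<open>The index - 1 belongs to moving the pole, which changes z^-3 in order - 4.
    Fixing the pole at 0 excludes it.\<close>
  hence "27 * (of_nat (n + 1) :: complex) = 0" by (simp add: algebra_simps)
  hence "(of_nat (n + 1) :: complex) = 0" unfolding mult_eq_0_iff by simp
  thus False unfolding of_nat_eq_0_iff by simp
qed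

text \<open>The order s of the pole is forced: comparing orders in the equation gives 3 * (s - 1) =
  4 * s, so s = - 3. Multiplication by \<open>fls_X ^ 3\<close> then leads to power series with
  nonzero constant term.\<close>

lemma fls_solution_unique:
  fixes F G :: "complex fls" and c :: complex
  assumes c: "c \<noteq> 0"
    and F: "fls_deriv F ^ 3 = fls_const c * F ^ 2 * (F - 1) ^ 2" "fls_subdegree F < 0"
    and G: "fls_deriv G ^ 3 = fls_const c * G ^ 2 * (G - 1) ^ 2" "fls_subdegree G < 0"
  shows "F = G"
proof -
  have *: "\<exists>H0. fls_X ^ 3 * H = fps_to_fls H0 \<and> fps_nth H0 0 \<noteq> 0 \<and>
     (fps_X * fps_deriv H0 - 3 * H0) ^ 3 = fps_const c * H0 ^ 2 * (H0 - fps_X ^ 3) ^ 2"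
    if H: "fls_deriv H ^ 3 = fls_const c * H ^ 2 * (H - 1) ^ 2" "fls_subdegree H < 0" for H
  proof -
    have "H \<noteq> 0" using H(2) by auto
    have "fls_subdegree (fls_deriv H) = fls_subdegree H - 1"
      using H(2) by (subst fls_subdegree_deriv) auto
    hence "fls_deriv H \<noteq> 0" using H(2) by auto
    have "fls_subdegree (H - 1) = fls_subdegree H"
      using H(2) by (subst fls_subdegree_diff_eq1) auto
    hence "H - 1 \<noteq> 0" using H(2) by auto
    have "3 * fls_subdegree (fls_deriv H) = fls_subdegree (fls_deriv H ^ 3)"
      by (simp add: fls_subdegree_pow)
    also have "\<dots> = 2 * fls_subdegree H + 2 * fls_subdegree (H - 1)"
      unfolding H(1) using c \<open>H \<noteq> 0\<close> \<open>H - 1 \<noteq> 0\<close> by (simp add: fls_subdegree_pow)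
    finally have sub: "fls_subdegree H = - 3"
      using \<open>fls_subdegree (H - 1) = fls_subdegree H\<close>
        \<open>fls_subdegree (fls_deriv H) = fls_subdegree H - 1\<close> by simp
    define H0 where "H0 = fls_base_factor_to_fps H"
    have nz: "fps_nth H0 0 \<noteq> 0" using \<open>H \<noteq> 0\<close> by (simp add: H0_def)
    define Y :: "complex fls" where "Y = fls_X"
    have YH: "Y ^ 3 * H = fps_to_fls H0"
      unfolding H0_def fps_to_fls_base_factor_to_fps Y_def
      by (simp add: sub fls_X_power_times_conv_shift)
    have "fls_deriv (Y ^ 3 * H) = 3 * Y ^ 2 * H + Y ^ 3 * fls_deriv H"
      by (simp add: Y_def fls_deriv_power)
    hence "fps_to_fls (fps_deriv H0) = 3 * Y ^ 2 * H + Y ^ 3 * fls_deriv H"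
      unfolding YH by (simp add: fls_deriv_fps_to_fls)
    \<comment> \<open>This is where the operator in \<open>fps_solution_unique\<close> comes from.
      Its cube carries the factor Y^12, which the right side of the equation absorbs as Y^6 *
      Y^6.\<close>
    hence "Y * fps_to_fls (fps_deriv H0) - 3 * (Y ^ 3 * H) = Y ^ 4 * fls_deriv H"
      by (simp add: algebra_simps power_numeral_reduce)
    hence "(Y * fps_to_fls (fps_deriv H0) - 3 * fps_to_fls H0) ^ 3 = Y ^ 12 * fls_deriv H ^ 3"
      unfolding YH by (simp add: power_mult_distrib flip: power_mult)
    also have "\<dots> = fls_const c * (Y ^ 3 * H) ^ 2 * (Y ^ 3 * H - Y ^ 3) ^ 2"
      unfolding H(1) by algebra
    finally have "fps_to_fls ((fps_X * fps_deriv H0 - 3 * H0) ^ 3) =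
        fps_to_fls (fps_const c * H0 ^ 2 * (H0 - fps_X ^ 3) ^ 2)"
      unfolding YH unfolding Y_def
      by (simp add: fls_times_fps_to_fls fps_to_fls_power fps_to_fls_minus)
    thus ?thesis using YH nz unfolding Y_def by (simp only: fps_to_fls_eq_iff) blast
  qed
  obtain F0 G0 where "fls_X ^ 3 * F = fps_to_fls F0" "fls_X ^ 3 * G = fps_to_fls G0" "F0 = G0"
    using *[OF F] *[OF G] fps_solution_unique[OF c] by metis
  hence "fls_X ^ 3 * F = fls_X ^ 3 * G" by simp
  thus ?thesis by simp
qed

section \<open>Fibres and ramification of the cover\<close>

lemma torus_point_eq_iff:
  assumes "is_lattice \<Lambda>"
  shows "torus_point \<Lambda> a = torus_point \<Lambda> b \<longleftrightarrow> a - b \<in> \<Lambda>"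
proof
  assume "torus_point \<Lambda> a = torus_point \<Lambda> b"
  moreover have "a \<in> torus_point \<Lambda> a"
    unfolding torus_point_def using lattice_zero[OF assms] by (auto intro!: image_eqI[of _ _ 0])
  ultimately have "a \<in> torus_point \<Lambda> b" by simp
  then obtain w where "w \<in> \<Lambda>" "a = b + w" unfolding torus_point_def by auto
  thus "a - b \<in> \<Lambda>" by simp
next
  have sub: "torus_point \<Lambda> a \<subseteq> torus_point \<Lambda> b" if "a - b \<in> \<Lambda>" for a b
  proof
    fix x assume "x \<in> torus_point \<Lambda> a"
    then obtain w where "w \<in> \<Lambda>" "x = a + w" unfolding torus_point_def by auto
    hence "x = b + (a - b + w)" "a - b + w \<in> \<Lambda>" using lattice_add[OF assms] that by auto
    thus "x \<in> torus_point \<Lambda> b" unfolding torus_point_def by blast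
  qed
  assume ab: "a - b \<in> \<Lambda>"
  hence "b - a \<in> \<Lambda>" using lattice_minus[OF assms ab] by simp
  thus "torus_point \<Lambda> a = torus_point \<Lambda> b" using sub ab by blast
qed

locale equianharmonic =
  fixes \<Lambda> :: "complex set" and f :: "complex \<Rightarrow> complex"
  assumes cover: "equianharmonic_cover \<Lambda> f"
begin

lemma lattice: "is_lattice \<Lambda>"
  and mero: "f nicely_meromorphic_on UNIV"
  and periodic: "w \<in> \<Lambda> \<Longrightarrow> f (z + w) = f z"
  and degree: "has_torus_degree \<Lambda> f 3"
  using cover unfolding equianharmonic_cover_def torus_morphism_def by simp_all

lemmas \<Lambda>_zero = lattice_zero[OF lattice]
  and \<Lambda>_add = lattice_add[OF lattice]
  and \<Lambda>_minus = lattice_minus[OF lattice]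

lemma \<Lambda>_diff: "x \<in> \<Lambda> \<Longrightarrow> y \<in> \<Lambda> \<Longrightarrow> x - y \<in> \<Lambda>"
  using \<Lambda>_add[of x "- y"] \<Lambda>_minus[of y] by simp

lemma meromorphic: "f meromorphic_on A"
  using mero meromorphic_on_subset unfolding nicely_meromorphic_on_def by blast

lemma nonconstant: "\<exists>\<^sub>F w in at z. f w \<noteq> c"
proof (rule ccontr)
  assume "\<not> ?thesis"
  hence "eventually (\<lambda>w. f w = c) (at z)" by (simp add: frequently_def)
  hence "frequently (\<lambda>w. f w = c) (at z)" by (simp add: eventually_frequently)
  hence "f w = c" for w
    by (rule frequently_eq_meromorphic_imp_constant[OF _ mero]) (simp_all add: connected_UNIV)
  hence "f constant_on UNIV" by (auto simp: constant_on_def)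
  thus False using degree by (simp add: has_torus_degree_def)
qed

lemma tendsto_value: "\<not> is_pole f z \<Longrightarrow> f \<midarrow>z\<rightarrow> f z"
  using mero unfolding nicely_meromorphic_on_def by auto

lemma laurent: "(\<lambda>u. f (z + u)) has_laurent_expansion laurent_expansion f z"
  using meromorphic_on_imp_has_laurent_expansion[OF meromorphic] by blast

lemma is_pole_periodic:
  assumes "w \<in> \<Lambda>" shows "is_pole f (z + w) \<longleftrightarrow> is_pole f z"
proof -
  have "f (z + w + u) = f (z + u)" for u
    using periodic[OF assms, of "z + u"] by (simp add: add_ac)
  thus ?thesis
    using is_pole_shift_0[of f "z + w"] is_pole_shift_0[of f z] by simp
qed

lemma proj_value_periodic: "w \<in> \<Lambda> \<Longrightarrow> proj_value f (z + w) = proj_value f z"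
  by (simp add: proj_value_def is_pole_periodic periodic)

lemma ram_index_periodic:
  assumes "w \<in> \<Lambda>" shows "ram_index f (z + w) = ram_index f z"
proof -
  have *: "f (u + (z + w)) = f (u + z)" for u
    using periodic[OF assms, of "u + z"] by (simp add: add.assoc)
  have "zorder f (z + w) = zorder f z"
    by (subst (1 2) zorder_shift) (simp add: *)
  moreover have "zorder (\<lambda>v. f v - f (z + w)) (z + w) = zorder (\<lambda>v. f v - f z) z"
    by (subst (1 2) zorder_shift) (simp add: * periodic[OF assms])
  ultimately show ?thesis
    by (simp add: ram_index_def is_pole_periodic[OF assms])
qed

text \<open>The conversion \<open>nat\<close> in \<open>ram_index\<close> loses nothing: the order
  at a pole is negative, and \<open>f w - f z\<close> vanishes at \<open>z\<close> without vanishing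
  identically nearby.\<close>

lemma ram_index_pos: "ram_index f z \<ge> 1"
proof (cases "is_pole f z")
  case True
  have "isolated_singularity_at f z"
    using meromorphic meromorphic_on_isolated_singularity by blast
  hence "zorder f z < 0" using True isolated_pole_imp_neg_zorder by blast
  thus ?thesis using True by (simp add: ram_index_def)
next
  case False
  have an: "(\<lambda>w. f w - f z) analytic_on {z}"
    using nicely_meromorphic_on_imp_analytic_at[OF mero _ False] by (auto intro!: analytic_intros)
  have "\<exists>\<^sub>F w in at z. f w - f z \<noteq> 0" using nonconstant by simp
  hence "zorder (\<lambda>w. f w - f z) z > 0"
    using zorder_pos_iff'[OF an] by simp
  thus ?thesis using False by (simp add: ram_index_def)
qed

lemma ram_index_torus_point: "the_elem (ram_index f ` torus_point \<Lambda> z) = ram_index f z"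
proof -
  have "ram_index f ` torus_point \<Lambda> z = {ram_index f z}"
    using \<Lambda>_zero ram_index_periodic unfolding torus_point_def by (auto simp: image_image)
  thus ?thesis by simp
qed

lemma finite_fibre: "finite (torus_fibre \<Lambda> f q)"
  and sum_fibre: "(\<Sum>P\<in>torus_fibre \<Lambda> f q. the_elem (ram_index f ` P)) = 3"
  using degree unfolding has_torus_degree_def by auto

lemma card_fibre: "card (torus_fibre \<Lambda> f q) \<le> 3"
proof -
  have "(\<Sum>P\<in>torus_fibre \<Lambda> f q. 1) \<le> (\<Sum>P\<in>torus_fibre \<Lambda> f q. the_elem (ram_index f ` P))"
    using ram_index_pos by (intro sum_mono) (auto simp: torus_fibre_def ram_index_torus_point)
  thus ?thesis using sum_fibre by simp
qed

lemma surj_proj_value: "\<exists>z. proj_value f z = q"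
proof (rule ccontr)
  assume "\<not> ?thesis"
  hence "torus_fibre \<Lambda> f q = {}" by (auto simp: torus_fibre_def)
  thus False using sum_fibre[of q] by simp
qed

text \<open>A fibre has at most three points, so three inequivalent ones exhaust it. This is meant
  for orbits under multiplication by \<open>\<epsilon>\<close>.\<close>

lemma fibre_cover:
  assumes v: "proj_value f a = q" "proj_value f b = q" "proj_value f c = q" "proj_value f d = q"
    and n: "a - b \<notin> \<Lambda>" "b - c \<notin> \<Lambda>" "c - a \<notin> \<Lambda>"
  shows "d - a \<in> \<Lambda> \<or> d - b \<in> \<Lambda> \<or> d - c \<in> \<Lambda>"
proof (rule ccontr)
  assume d: "\<not> ?thesis"
  let ?P = "torus_point \<Lambda>"
  have "c - b \<notin> \<Lambda>" "a - c \<notin> \<Lambda>" using n \<Lambda>_minus by (metis minus_diff_eq)+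
  hence "card {?P d, ?P a, ?P b, ?P c} = 4"
    using d n by (simp add: torus_point_eq_iff[OF lattice])
  moreover have "{?P d, ?P a, ?P b, ?P c} \<subseteq> torus_fibre \<Lambda> f q"
    using v by (auto simp: torus_fibre_def)
  ultimately have "4 \<le> card (torus_fibre \<Lambda> f q)"
    using card_mono[OF finite_fibre] by metis
  thus False using card_fibre[of q] by linarith
qed

text \<open>A point of index 3 uses up the whole degree, and a second point in its fibre would
  contribute at least 1 more.\<close>

lemma total_ramification:
  assumes "ram_index f a = 3" "proj_value f b = proj_value f a"
  shows "b - a \<in> \<Lambda>"
proof (rule ccontr)
  assume "b - a \<notin> \<Lambda>"
  hence ne: "torus_point \<Lambda> b \<noteq> torus_point \<Lambda> a" by (simp add: torus_point_eq_iff[OF lattice])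
  let ?F = "torus_fibre \<Lambda> f (proj_value f a)"
  have "{torus_point \<Lambda> b, torus_point \<Lambda> a} \<subseteq> ?F"
    using assms by (auto simp: torus_fibre_def)
  hence "(\<Sum>P\<in>{torus_point \<Lambda> b, torus_point \<Lambda> a}. the_elem (ram_index f ` P)) \<le>
      (\<Sum>P\<in>?F. the_elem (ram_index f ` P))"
    using finite_fibre by (intro sum_mono2) auto
  hence "ram_index f b + ram_index f a \<le> 3"
    using ne by (simp add: ram_index_torus_point sum_fibre)
  thus False using assms ram_index_pos[of b] by simp
qed

lemma ram_index_3_special: "ram_index f z = 3 \<Longrightarrow> proj_value f z \<in> special_points"
proof -
  assume "ram_index f z = 3"
  hence "proj_value f z \<in> proj_value f ` {z. ram_index f z > 1}" by simp
  thus ?thesis using cover by (simp add: equianharmonic_cover_def)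
qed

text \<open>By counting: the three totally ramified points have pairwise different values by
  \<open>total_ramification\<close>, and these lie in a set of three elements, so each special point
  is one of them. Its fibre then consists of that ramified point alone.\<close>

lemma special_ram_index:
  assumes "proj_value f z \<in> special_points" shows "ram_index f z = 3"
proof -
  define R where "R = {z. ram_index f z = 3}"
  have "card (torus_point \<Lambda> ` R) = 3"
    using cover unfolding equianharmonic_cover_def R_def by blast
  hence fin: "finite (torus_point \<Lambda> ` R)" by (metis card.infinite numeral_neq_zero)
  define S where "S = (\<lambda>P. the_elem (proj_value f ` P)) ` (torus_point \<Lambda> ` R)"
  have val: "the_elem (proj_value f ` torus_point \<Lambda> z) = proj_value f z" for z
  proof -
    have "proj_value f ` torus_point \<Lambda> z = {proj_value f z}"
      using \<Lambda>_zero proj_value_periodic unfolding torus_point_def by (auto simp: image_image)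
    thus ?thesis by simp
  qed
  have "inj_on (\<lambda>P. the_elem (proj_value f ` P)) (torus_point \<Lambda> ` R)"
  proof (rule inj_onI)
    fix P Q assume PQ: "P \<in> torus_point \<Lambda> ` R" "Q \<in> torus_point \<Lambda> ` R"
      "the_elem (proj_value f ` P) = the_elem (proj_value f ` Q)"
    then obtain a b where "ram_index f b = 3" "P = torus_point \<Lambda> a" "Q = torus_point \<Lambda> b"
      unfolding R_def by blast
    thus "P = Q"
      using PQ(3) total_ramification[of b a] by (simp add: val torus_point_eq_iff[OF lattice])
  qed
  hence "card S = 3"
    unfolding S_def using \<open>card (torus_point \<Lambda> ` R) = 3\<close> by (simp add: card_image)
  moreover have "S \<subseteq> special_points"
    by (auto simp: S_def val R_def ram_index_3_special)
  moreover have "card special_points = 3" "finite special_points" by (auto simp: special_points_def)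
  ultimately have "S = special_points" by (metis card_subset_eq)
  hence "proj_value f z \<in> S" using assms by simp
  then obtain a where a: "ram_index f a = 3" "proj_value f z = proj_value f a"
    by (auto simp: S_def val R_def)
  hence "z - a \<in> \<Lambda>" by (rule total_ramification)
  thus ?thesis using ram_index_periodic[of "z - a" a] a(1) by simp
qed

lemma special_value_unique:
  assumes "proj_value f a \<in> special_points" "proj_value f b = proj_value f a"
  shows "b - a \<in> \<Lambda>"
  using total_ramification special_ram_index assms by blast

section \<open>Laurent expansions of \<open>f\<close> and the constant of the differential
  equation\<close>

lemma laurent_expansion_neq_const: "laurent_expansion f z \<noteq> fls_const c"
proof
  assume "laurent_expansion f z = fls_const c"
  hence "(\<lambda>u. f (z + u) - c) has_laurent_expansion (fls_const c - fls_const c)"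
    using has_laurent_expansion_diff[OF laurent[of z] has_laurent_expansion_const[of c]] by simp
  hence "eventually (\<lambda>u. f u - c = 0) (at z)"
    using has_laurent_expansion_eventually_zero_iff[of "\<lambda>u. f u - c" z] by simp
  thus False using nonconstant[of c z] by (simp add: frequently_def)
qed

lemma eventually_neq: "\<forall>\<^sub>F w in at z. f w \<noteq> a"
proof -
  have "(\<lambda>u. f (z + u) - a) has_laurent_expansion laurent_expansion f z - fls_const a"
    by (intro laurent_expansion_intros laurent)
  thus ?thesis
    using has_laurent_expansion_eventually_nonzero_iff[of "\<lambda>u. f u - a" z]
      laurent_expansion_neq_const[of z a] by simp
qed

text \<open>
  By the ramification of \<open>f\<close> the quotient of the two sides has neither a zero nor a pole.
\<close>

lemma exists_differential_equation:
  "\<exists>c. c \<noteq> 0 \<and> (\<forall>z. \<forall>\<^sub>F w in at z. deriv f w ^ 3 = c * f w ^ 2 * (f w - 1) ^ 2)"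
proof -
  define G where "G = (\<lambda>w. deriv f w ^ 3 / (f w ^ 2 * (f w - 1) ^ 2))"
  have lG: "(\<lambda>u. G (z + u)) has_laurent_expansion
      (fls_deriv (laurent_expansion f z) ^ 3 /
        (laurent_expansion f z ^ 2 * (laurent_expansion f z - 1) ^ 2))" for z
  proof -
    have "deriv (\<lambda>u. f (z + u)) = (\<lambda>u. deriv f (z + u))"
      by (rule ext, subst (1 2) deriv_shift_0) (simp add: o_def add.assoc)
    hence "(\<lambda>u. deriv f (z + u)) has_laurent_expansion fls_deriv (laurent_expansion f z)"
      using has_laurent_expansion_deriv[OF laurent[of z]] by simp
    thus ?thesis unfolding G_def
      by (intro has_laurent_expansion_divide has_laurent_expansion_mult has_laurent_expansion_power
        has_laurent_expansion_diff has_laurent_expansion_1 laurent)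
  qed
  have "\<not> is_pole G z" for z
  proof -
    define F where "F = laurent_expansion f z"
    have F01: "F \<noteq> 0" "F \<noteq> 1" using laurent_expansion_neq_const[of z 0] laurent_expansion_neq_const[of z 1] by (auto simp: F_def)
    have lF: "(\<lambda>u. f (z + u)) has_laurent_expansion F" unfolding F_def by (rule laurent)
    have lF1: "(\<lambda>u. f (z + u) - 1) has_laurent_expansion (F - 1)"
      using lF by (intro laurent_expansion_intros)
    have ord: "zorder f z = fls_subdegree F" "zorder (\<lambda>w. f w - 1) z = fls_subdegree (F - 1)"
      using has_laurent_expansion_zorder[OF lF] has_laurent_expansion_zorder[of "\<lambda>w. f w - 1", OF lF1] F01
      by auto
    have "fls_subdegree F = - 3 \<or> fls_subdegree F = 3 \<or> fls_subdegree (F - 1) = 3 \<or>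
      F \<noteq> 0 \<and> F \<noteq> 1 \<and> fls_subdegree F = 0 \<and> fls_subdegree (F - 1) = 0"
    \<comment> \<open>Over a special point one of the first three alternatives is the index 3;
      elsewhere \<open>f\<close> and \<open>f - 1\<close> are analytic and nonzero.\<close>
    proof (cases "proj_value f z \<in> special_points")
      case True
      hence "ram_index f z = 3" by (rule special_ram_index)
      thus ?thesis using True ord
        by (auto simp: ram_index_def proj_value_def special_points_def split: if_splits)
    next
      case False
      hence np: "\<not> is_pole f z" and v: "f z \<noteq> 0" "f z - 1 \<noteq> 0"
        by (auto simp: proj_value_def special_points_def split: if_splits)
      have an: "f analytic_on {z}" "(\<lambda>w. f w - 1) analytic_on {z}"
        using nicely_meromorphic_on_imp_analytic_at[OF mero _ np] by (auto intro!: analytic_intros)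
      show ?thesis using F01 zorder_eq_0I[OF an(1)] zorder_eq_0I[OF an(2)] v ord by auto
    qed
    hence "0 \<le> fls_subdegree (fls_deriv F ^ 3 / (F ^ 2 * (F - 1) ^ 2))"
      by (rule cubic_quotient_subdegree)
    thus ?thesis using is_pole_fls_subdegree_iff[OF lG[of z]] by (simp add: F_def)
  qed
  moreover have "G meromorphic_on UNIV"
    unfolding G_def by (intro meromorphic_intros meromorphic)
  moreover have "G (z + w) = G z" if "w \<in> \<Lambda>" for z w
  proof -
    have "(\<lambda>u. f (u + w)) = f" by (rule ext) (rule periodic[OF that])
    moreover have "deriv f (z + w) = deriv (\<lambda>u. f (u + w)) z"
      using deriv_shift_0[of f "z + w"] deriv_shift_0[of "\<lambda>u. f (u + w)" z]
      by (simp add: o_def add_ac)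
    ultimately have "deriv f (z + w) = deriv f z" by simp
    thus ?thesis by (simp add: G_def periodic[OF that])
  qed
  ultimately obtain c where c: "\<And>z. eventually (\<lambda>x. G x = c) (at z)"
    using periodic_without_poles_is_constant[OF lattice, of G] by metis
  have ev: "\<forall>\<^sub>F w in at z. deriv f w ^ 3 = c * f w ^ 2 * (f w - 1) ^ 2" for z
    using c[of z] eventually_neq[of 0 z] eventually_neq[of 1 z] by eventually_elim (auto simp: G_def field_simps)
  have "c \<noteq> 0"
  proof
    assume "c = 0"
    hence "\<forall>\<^sub>F w in at 0. deriv f w = 0" using ev[of 0] by simp
    moreover have "(\<lambda>u. deriv f (0 + u)) has_laurent_expansion fls_deriv (laurent_expansion f 0)"
      using has_laurent_expansion_deriv[OF laurent[of 0]] by simp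
    ultimately have "fls_deriv (laurent_expansion f 0) = 0"
      using has_laurent_expansion_eventually_zero_iff[of "deriv f" 0] by blast
    thus False using laurent_expansion_neq_const[of 0] fls_deriv_eq_0_iff[of "laurent_expansion f 0"] by auto
  qed
  thus ?thesis using ev by blast
qed

end

section \<open>Complex multiplication, negation and doubling\<close>

text \<open>This carries limits, poles and eventual statements over between \<open>f\<close> at
  \<open>q + a * z\<close> and its pullback at \<open>z\<close>.\<close>

lemma filtermap_affine_at:
  fixes a q z :: complex
  assumes "a \<noteq> 0"
  shows "filtermap (\<lambda>w. q + a * w) (at z) = at (q + a * z)"
proof (rule filtermap_fun_inverse[where g = "\<lambda>w. (w - q) / a"])
  have "(w - q) / a = z \<longleftrightarrow> w = q + a * z" for w
    using assms by (auto simp: field_simps)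
  thus "filterlim (\<lambda>w. (w - q) / a) (at z) (at (q + a * z))"
    using assms by (auto simp: filterlim_at eventually_at_filter intro!: tendsto_eq_intros)
  show "filterlim (\<lambda>w. q + a * w) (at (q + a * z)) (at z)"
    using assms by (auto simp: filterlim_at eventually_at_filter intro!: tendsto_eq_intros)
qed (use assms in auto)

text \<open>The difference of the functions vanishes either off a sparse set or only on a sparse
  set, and its behaviour near \<open>a\<close> excludes the latter.\<close>

lemma meromorphic_identity:
  assumes "g meromorphic_on UNIV" "h meromorphic_on UNIV" "\<forall>\<^sub>F w in at a. g w = h w"
  shows "\<forall>\<^sub>F w in at z. g w = h w"
proof -
  have "(\<lambda>w. g w - h w) meromorphic_on UNIV"
    using assms by (intro meromorphic_intros)
  hence "eventually (\<lambda>w. g w - h w = 0) (cosparse UNIV) \<or> eventually (\<lambda>w. g w - h w \<noteq> 0) (cosparse UNIV)"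
    by (rule meromorphic_imp_constant_or_avoid) (simp_all add: connected_UNIV)
  moreover have "\<not> eventually (\<lambda>w. g w - h w \<noteq> 0) (at a)"
  proof
    assume "eventually (\<lambda>w. g w - h w \<noteq> 0) (at a)"
    with assms(3) have "eventually (\<lambda>w. False) (at a)" by eventually_elim simp
    thus False by simp
  qed
  ultimately show ?thesis by (auto simp: eventually_cosparse_open_eq)
qed

text \<open>Near 0 the two Laurent expansions solve the same formal equation and hence coincide;
  \<open>meromorphic_identity\<close> carries the equality from 0 to \<open>z\<close>.\<close>

lemma differential_equation_unique:
  fixes g h :: "complex \<Rightarrow> complex"
  assumes "c \<noteq> 0"
    and g: "g meromorphic_on UNIV" "is_pole g 0"
      "\<forall>\<^sub>F w in at 0. deriv g w ^ 3 = c * g w ^ 2 * (g w - 1) ^ 2"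
    and h: "h meromorphic_on UNIV" "is_pole h 0"
      "\<forall>\<^sub>F w in at 0. deriv h w ^ 3 = c * h w ^ 2 * (h w - 1) ^ 2"
  shows "\<forall>\<^sub>F w in at z. g w = h w"
proof -
  have *: "\<exists>G. g has_laurent_expansion G \<and> fls_subdegree G < 0 \<and>
      fls_deriv G ^ 3 = fls_const c * G ^ 2 * (G - 1) ^ 2"
    if g: "g meromorphic_on UNIV" "is_pole g 0"
      "\<forall>\<^sub>F w in at 0. deriv g w ^ 3 = c * g w ^ 2 * (g w - 1) ^ 2" for g
  proof -
    define G where "G = laurent_expansion g 0"
    have G: "g has_laurent_expansion G"
      using meromorphic_on_imp_has_laurent_expansion[OF g(1), of 0] by (simp add: G_def)
    have "(\<lambda>w. deriv g w ^ 3) has_laurent_expansion fls_deriv G ^ 3"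
      by (intro laurent_expansion_intros G)
    moreover have "(\<lambda>w. c * g w ^ 2 * (g w - 1) ^ 2) has_laurent_expansion
        (fls_const c * G ^ 2 * (G - 1) ^ 2)"
      by (intro has_laurent_expansion_mult has_laurent_expansion_power has_laurent_expansion_diff
        has_laurent_expansion_const has_laurent_expansion_1 G)
    ultimately have "fls_deriv G ^ 3 = fls_const c * G ^ 2 * (G - 1) ^ 2"
      using has_laurent_expansion_cong[OF g(3) refl] has_laurent_expansion_unique by blast
    thus ?thesis using G is_pole_0_imp_neg_fls_subdegree[OF G g(2)] by blast
  qed
  obtain G H where "g has_laurent_expansion G" "h has_laurent_expansion H" "G = H"
    using *[OF g] *[OF h] fls_solution_unique[OF assms(1)] by metis
  hence "(\<lambda>w. g w - h w) has_laurent_expansion 0"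
    using has_laurent_expansion_diff by fastforce
  hence "\<forall>\<^sub>F w in at 0. g w - h w = 0"
    using has_laurent_expansion_eventually_zero_iff[of "\<lambda>w. g w - h w" 0] by simp
  hence "\<forall>\<^sub>F w in at 0. g w = h w" by simp
  thus ?thesis using meromorphic_identity g h by blast
qed

text \<open>
  In the coordinate \<open>v = 2 * u - 1\<close> this is the second coordinate \<open>(v^4 + 18 * v^2 - 27) / (8 * v^3)\<close> of the
  duplication map on the Weierstrass curve \<open>v^2 = X^3 + 1\<close>.
\<close>

definition doubling :: "complex \<Rightarrow> complex" where
  "doubling u = (u + 1) ^ 3 * (u - 1) / (2 * u - 1) ^ 3"

text \<open>The triple points of \<open>doubling\<close> are - 1 over 0, 2 over 1 and 1/2 over
  infinity. This accounts for the two double zeros of the derivative and for the exponent 4 in its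
  denominator.\<close>

lemma has_field_derivative_doubling:
  assumes "2 * u - 1 \<noteq> 0"
  shows "(doubling has_field_derivative 2 * ((u + 1) * (u - 2)) ^ 2 / (2 * u - 1) ^ 4) (at u)"
proof -
  have "((\<lambda>u. (u + 1) ^ 3 * (u - 1) / (2 * u - 1) ^ 3) has_field_derivative
     (((3 * (u + 1) ^ 2 * (u - 1) + (u + 1) ^ 3) * (2 * u - 1) ^ 3 -
       (u + 1) ^ 3 * (u - 1) * (6 * (2 * u - 1) ^ 2)) / ((2 * u - 1) ^ 3 * (2 * u - 1) ^ 3))) (at u)"
    using assms by (auto intro!: derivative_eq_intros)
  moreover have "((3 * (u + 1) ^ 2 * (u - 1) + (u + 1) ^ 3) * (2 * u - 1) ^ 3 -
       (u + 1) ^ 3 * (u - 1) * (6 * (2 * u - 1) ^ 2)) / ((2 * u - 1) ^ 3 * (2 * u - 1) ^ 3) =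
       2 * ((u + 1) * (u - 2)) ^ 2 / (2 * u - 1) ^ 4"
    using assms by (subst frac_eq_eq) (simp, simp, algebra)
  ultimately show ?thesis unfolding doubling_def by simp
qed

lemma doubling_minus_1:
  "2 * u - 1 \<noteq> 0 \<Longrightarrow> doubling u - 1 = u * (u - 2) ^ 3 / (2 * u - 1) ^ 3"
  unfolding doubling_def by (simp add: divide_simps) algebra

lemma doubling_eq_iff:
  "2 * u \<noteq> 1 \<Longrightarrow> doubling u = s \<longleftrightarrow> (u + 1) ^ 3 * (u - 1) = s * (2 * u - 1) ^ 3"
  unfolding doubling_def by (subst divide_eq_eq) simp

text \<open>The new factor 8 is the cube of the 2 in the derivative of \<open>doubling\<close>. It
  agrees with the factor 2^3 that arises from substituting 2 z into \<open>f\<close>.\<close>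

lemma doubling_differential_equation:
  assumes "2 * u - 1 \<noteq> 0" "d ^ 3 = c * u ^ 2 * (u - 1) ^ 2"
  shows "(2 * ((u + 1) * (u - 2)) ^ 2 / (2 * u - 1) ^ 4 * d) ^ 3 =
    8 * c * doubling u ^ 2 * (doubling u - 1) ^ 2"
proof -
  have "(2 * ((u + 1) * (u - 2)) ^ 2 / (2 * u - 1) ^ 4 * d) ^ 3 =
      8 * ((u + 1) * (u - 2)) ^ 6 * (c * u ^ 2 * (u - 1) ^ 2) / (2 * u - 1) ^ 12"
    by (simp add: power_mult_distrib power_divide assms(2) flip: power_mult)
  also have "\<dots> = 8 * c * doubling u ^ 2 * (doubling u - 1) ^ 2"
    unfolding doubling_minus_1[OF assms(1)] unfolding doubling_def
    by (simp add: power_mult_distrib power_divide flip: power_mult power_add)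
  finally show ?thesis .
qed

text \<open>At infinity \<open>doubling u\<close> grows like u / 8. The quotient of
  \<open>doubling u\<close> by \<open>u\<close> is written in terms of \<open>inverse u\<close>,
  which tends to 0.\<close>

lemma is_pole_doubling:
  fixes g :: "complex \<Rightarrow> complex"
  assumes "is_pole g z" shows "is_pole (\<lambda>w. doubling (g w)) z"
proof -
  have inv: "((\<lambda>w. inverse (g w)) \<longlongrightarrow> 0) (at z)"
    using assms unfolding is_pole_def by (rule tendsto_inverse_0[THEN filterlim_compose])
  have "((\<lambda>w. (1 + inverse (g w)) ^ 3 * (1 - inverse (g w)) / (2 - inverse (g w)) ^ 3)
      \<longlongrightarrow> (1 + 0) ^ 3 * (1 - 0) / (2 - 0) ^ 3) (at z)"
    by (intro tendsto_intros inv) simp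
  hence "filterlim (\<lambda>w. (1 + inverse (g w)) ^ 3 * (1 - inverse (g w)) / (2 - inverse (g w)) ^ 3 * g w)
      at_infinity (at z)"
    using assms unfolding is_pole_def
    by (intro tendsto_mult_filterlim_at_infinity[where c = "1 / 8"]) simp_all
  moreover have "\<forall>\<^sub>F w in at z. g w \<noteq> 0"
    using assms by (rule non_zero_neighbour_pole)
  hence "\<forall>\<^sub>F w in at z. (1 + inverse (g w)) ^ 3 * (1 - inverse (g w)) / (2 - inverse (g w)) ^ 3 * g w
      = doubling (g w)"
  proof eventually_elim
    case (elim w)
    define i where "i = inverse (g w)"
    have g: "g w * i = 1" using elim by (simp add: i_def)
    have f: "g w + 1 = g w * (1 + i)" "g w - 1 = g w * (1 - i)" "2 * g w - 1 = g w * (2 - i)"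
      using g by (simp_all add: algebra_simps)
    have num: "(g w + 1) ^ 3 * (g w - 1) = g w ^ 4 * ((1 + i) ^ 3 * (1 - i))"
      unfolding f by (simp add: power4_eq_xxxx power3_eq_cube)
    have den: "(2 * g w - 1) ^ 3 = g w ^ 3 * (2 - i) ^ 3"
      unfolding f by (rule power_mult_distrib)
    \<comment> \<open>For B = 0 both sides are 0 by the convention on division.\<close>
    have quot: "A / B * x = x ^ 4 * A / (x ^ 3 * B)" if "x \<noteq> 0" for x A B :: complex
      using that by (cases "B = 0") (simp_all add: divide_simps power4_eq_xxxx power3_eq_cube)
    show ?case
      unfolding doubling_def num den i_def[symmetric] using elim by (rule quot)
  qed
  ultimately show ?thesis
    unfolding is_pole_def by (rule filterlim_cong[OF refl refl, THEN iffD1, rotated])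
qed

text \<open>The numerator has a nonzero limit and the denominator tends to 0. The second assumption
  keeps the denominator from vanishing near \<open>z\<close>, where the quotient would take the
  default value 0.\<close>

lemma is_pole_doubling_half:
  fixes g :: "complex \<Rightarrow> complex"
  assumes "g \<midarrow>z\<rightarrow> 1 / 2" "\<forall>\<^sub>F w in at z. g w \<noteq> 1 / 2"
  shows "is_pole (\<lambda>w. doubling (g w)) z"
proof -
  have "filterlim (\<lambda>w. (2 * g w - 1) ^ 3) (at 0) (at z)"
  proof (rule filterlim_atI)
    have "((\<lambda>w. (2 * g w - 1) ^ 3) \<longlongrightarrow> (2 * (1 / 2) - 1) ^ 3) (at z)"
      by (intro tendsto_intros assms(1))
    thus "((\<lambda>w. (2 * g w - 1) ^ 3) \<longlongrightarrow> 0) (at z)" by simp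
    show "\<forall>\<^sub>F w in at z. (2 * g w - 1) ^ 3 \<noteq> 0"
      using assms(2) by eventually_elim (auto simp: field_simps)
  qed
  hence "filterlim (\<lambda>w. inverse ((2 * g w - 1) ^ 3)) at_infinity (at z)"
    by (rule filterlim_compose[OF filterlim_inverse_at_infinity])
  moreover have "((\<lambda>w. (g w + 1) ^ 3 * (g w - 1)) \<longlongrightarrow> (1 / 2 + 1) ^ 3 * (1 / 2 - 1)) (at z)"
    by (intro tendsto_intros assms(1))
  ultimately show ?thesis unfolding is_pole_def doubling_def divide_inverse
    by (intro tendsto_mult_filterlim_at_infinity) auto
qed

section \<open>Values of \<open>f\<close> with respect to the zero \<open>q\<close> of the group
  law\<close>

context equianharmonic
begin

context
  fixes q :: complex
  assumes q: "is_pole f q"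
begin

text \<open>
  \<open>pull a\<close> is \<open>f\<close> along multiplication by \<open>a\<close>, and \<open>val\<close> is the morphism itself, both with respect to the
  group law with zero \<open>q\<close>.
\<close>

definition pull :: "complex \<Rightarrow> complex \<Rightarrow> complex" where "pull a w = f (q + a * w)"

definition val :: "complex \<Rightarrow> proj_line" where "val z = proj_value f (q + z)"

lemma pull_meromorphic: "pull a meromorphic_on UNIV"
  unfolding pull_def[abs_def]
  by (rule meromorphic_on_compose[OF meromorphic]) (auto intro!: analytic_intros)

lemma is_pole_pull_iff: "a \<noteq> 0 \<Longrightarrow> is_pole (pull a) z \<longleftrightarrow> is_pole f (q + a * z)"
  using is_pole_compose_iff[OF filtermap_affine_at[of a q z], of f]
  by (simp add: pull_def[abs_def] o_def)

text \<open>With the next three lemmas this passes between germs and values: \<open>f\<close> is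
  nicely meromorphic, so a punctured neighbourhood determines the value in the middle.\<close>

lemma pull_tendsto:
  assumes "a \<noteq> 0" "pull a \<midarrow>z\<rightarrow> L" shows "val (a * z) = Some L"
proof -
  have lim: "f \<midarrow>q + a * z\<rightarrow> L"
    using assms unfolding filtermap_affine_at[OF assms(1), symmetric] filterlim_filtermap
    by (simp add: pull_def[abs_def])
  hence np: "\<not> is_pole f (q + a * z)"
    unfolding is_pole_def using not_tendsto_and_filterlim_at_infinity[OF _ lim] by auto
  hence "f (q + a * z) = L" using tendsto_value lim LIM_unique by blast
  thus ?thesis using np by (simp add: val_def proj_value_def)
qed

lemma pull_is_pole: "a \<noteq> 0 \<Longrightarrow> is_pole (pull a) z \<Longrightarrow> val (a * z) = None"
  by (simp add: is_pole_pull_iff val_def proj_value_def)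

lemma val_None: "val z = None \<Longrightarrow> is_pole (pull 1) z"
  by (simp add: is_pole_pull_iff val_def proj_value_def split: if_splits)

lemma val_Some: "val z = Some u \<Longrightarrow> pull 1 \<midarrow>z\<rightarrow> u"
proof -
  assume "val z = Some u"
  hence "f \<midarrow>q + 1 * z\<rightarrow> u"
    using tendsto_value by (auto simp: val_def proj_value_def split: if_splits)
  thus ?thesis
    unfolding filtermap_affine_at[OF one_neq_zero, symmetric] filterlim_filtermap
    by (simp add: pull_def[abs_def])
qed

lemma eventually_differentiable:
  assumes "a \<noteq> 0" shows "\<forall>\<^sub>F w in at z. f field_differentiable at (q + a * w)"
proof -
  have "isolated_singularity_at f (q + a * z)"
    using meromorphic meromorphic_on_isolated_singularity by blast
  hence "\<forall>\<^sub>F w in at (q + a * z). f analytic_on {w}"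
    unfolding isolated_singularity_at_altdef .
  hence "\<forall>\<^sub>F w in at z. f analytic_on {q + a * w}"
    unfolding filtermap_affine_at[OF assms, symmetric] eventually_filtermap .
  thus ?thesis
    by eventually_elim (auto intro: analytic_on_imp_differentiable_at)
qed

lemma deriv_pull:
  assumes "a \<noteq> 0" shows "\<forall>\<^sub>F w in at z. (pull a has_field_derivative a * deriv f (q + a * w)) (at w)"
  using eventually_differentiable[OF assms]
proof eventually_elim
  case (elim w)
  hence "(f has_field_derivative deriv f (q + a * w)) (at (q + a * w))"
    by (simp add: DERIV_deriv_iff_field_differentiable)
  hence "((\<lambda>w. f (q + a * w)) has_field_derivative deriv f (q + a * w) * a) (at w)"
    by (rule DERIV_chain2) (auto intro!: derivative_eq_intros)
  thus ?case by (simp add: pull_def[abs_def] mult.commute)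
qed

lemma pull_differential_equation:
  assumes "a \<noteq> 0" and ode: "\<And>z. \<forall>\<^sub>F w in at z. deriv f w ^ 3 = c * f w ^ 2 * (f w - 1) ^ 2"
  shows "\<forall>\<^sub>F w in at z. deriv (pull a) w ^ 3 = a ^ 3 * c * pull a w ^ 2 * (pull a w - 1) ^ 2"
proof -
  have "\<forall>\<^sub>F w in at z. deriv f (q + a * w) ^ 3 = c * f (q + a * w) ^ 2 * (f (q + a * w) - 1) ^ 2"
    using ode[of "q + a * z"]
    unfolding filtermap_affine_at[OF assms(1), symmetric] eventually_filtermap .
  with deriv_pull[OF assms(1)] show ?thesis
  proof eventually_elim
    case (elim w)
    thus ?case using DERIV_imp_deriv[OF elim(1)] by (simp add: pull_def power_mult_distrib)
  qed
qed

lemma pull_is_pole_0: "a \<noteq> 0 \<Longrightarrow> is_pole (pull a) 0"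
  using q by (simp add: is_pole_pull_iff)

lemma pull_cube_root_of_unity:
  assumes "a ^ 3 = 1" shows "\<forall>\<^sub>F w in at z. pull a w = pull 1 w"
proof -
  obtain c where c: "c \<noteq> 0" "\<And>z. \<forall>\<^sub>F w in at z. deriv f w ^ 3 = c * f w ^ 2 * (f w - 1) ^ 2"
    using exists_differential_equation by blast
  have "a \<noteq> 0" using assms by auto
  show ?thesis
    by (rule differential_equation_unique[OF c(1) pull_meromorphic pull_is_pole_0[OF \<open>a \<noteq> 0\<close>] _
          pull_meromorphic pull_is_pole_0[OF one_neq_zero]])
       (use pull_differential_equation[OF \<open>a \<noteq> 0\<close> c(2), of 0]
          pull_differential_equation[OF one_neq_zero c(2), of 0] assms in simp_all)
qed

text \<open>Substituting \<open>- w\<close> changes the sign of the constant in the equation, and u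
  \<mapsto> 1 - u changes it back: it reverses the derivative and exchanges the two squares.\<close>

lemma pull_minus: "\<forall>\<^sub>F w in at z. pull (- 1) w = 1 - pull 1 w"
proof -
  obtain c where c: "c \<noteq> 0" "\<And>z. \<forall>\<^sub>F w in at z. deriv f w ^ 3 = c * f w ^ 2 * (f w - 1) ^ 2"
    using exists_differential_equation by blast
  have neg1: "- 1 \<noteq> (0::complex)" by simp
  have d: "\<forall>\<^sub>F w in at 0. deriv (\<lambda>w. 1 - pull (- 1) w) w ^ 3 = c * (1 - pull (- 1) w) ^ 2 * (1 - pull (- 1) w - 1) ^ 2"
    using pull_differential_equation[OF neg1 c(2), of 0] deriv_pull[OF neg1, of 0]
  proof eventually_elim
    case (elim w)
    have "deriv (\<lambda>w. 1 - pull (- 1) w) w = - deriv (pull (- 1)) w"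
      using elim(2) by (intro DERIV_imp_deriv) (auto intro!: derivative_eq_intros simp: DERIV_imp_deriv)
    thus ?case using elim(1) by (simp add: power2_commute)
  qed
  have p: "is_pole (\<lambda>w. 1 - pull (- 1) w) 0"
    using pull_is_pole_0[OF neg1] is_pole_plus_const_iff[of "\<lambda>w. - pull (- 1) w" 0 1] by simp
  have m: "(\<lambda>w. 1 - pull (- 1) w) meromorphic_on UNIV"
    by (intro meromorphic_intros pull_meromorphic)
  have "\<forall>\<^sub>F w in at z. 1 - pull (- 1) w = pull 1 w"
    by (rule differential_equation_unique[OF c(1) m p d pull_meromorphic pull_is_pole_0[OF one_neq_zero]])
       (use pull_differential_equation[OF one_neq_zero c(2), of 0] in simp)
  thus ?thesis by eventually_elim (simp add: algebra_simps)
qed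

lemma pull_double: "\<forall>\<^sub>F w in at z. pull 2 w = doubling (pull 1 w)"
proof -
  obtain c where c: "c \<noteq> 0" "\<And>z. \<forall>\<^sub>F w in at z. deriv f w ^ 3 = c * f w ^ 2 * (f w - 1) ^ 2"
    using exists_differential_equation by blast
  \<comment> \<open>The equation for the doubled function is checked near 0 only, where the pole
    keeps \<open>pull 1\<close> away from 1/2.\<close>
  have "filterlim (pull 1) at_infinity (at 0)"
    using pull_is_pole_0[of 1] by (simp add: is_pole_def)
  hence "\<forall>\<^sub>F w in at 0. pull 1 w \<noteq> 1 / 2"
    by (rule filterlim_at_infinity_imp_eventually_ne)
  with pull_differential_equation[OF one_neq_zero c(2), of 0] deriv_pull[OF one_neq_zero, of 0]
  have "\<forall>\<^sub>F w in at 0. deriv (\<lambda>w. doubling (pull 1 w)) w ^ 3 =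
      8 * c * doubling (pull 1 w) ^ 2 * (doubling (pull 1 w) - 1) ^ 2"
  proof eventually_elim
    case (elim w)
    let ?u = "pull 1 w"
    have u: "2 * ?u - 1 \<noteq> 0" using elim(3) by (auto simp: field_simps)
    have d: "(pull 1 has_field_derivative deriv (pull 1) w) (at w)"
      using elim(2) by (simp add: DERIV_imp_deriv)
    have "deriv (\<lambda>w. doubling (pull 1 w)) w = 2 * ((?u + 1) * (?u - 2)) ^ 2 / (2 * ?u - 1) ^ 4 * deriv (pull 1) w"
      by (rule DERIV_imp_deriv, rule DERIV_chain2[OF has_field_derivative_doubling[OF u] d])
    thus ?case using doubling_differential_equation[OF u] elim(1) by simp
  qed
  moreover have "(\<lambda>w. doubling (pull 1 w)) meromorphic_on UNIV"
    unfolding doubling_def by (intro meromorphic_intros pull_meromorphic)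
  moreover have "is_pole (\<lambda>w. doubling (pull 1 w)) 0"
    by (intro is_pole_doubling pull_is_pole_0) simp
  moreover have "\<forall>\<^sub>F w in at 0. deriv (pull 2) w ^ 3 = 8 * c * pull 2 w ^ 2 * (pull 2 w - 1) ^ 2"
    using pull_differential_equation[of 2, OF _ c(2), of 0] by simp
  moreover have "8 * c \<noteq> 0" using c(1) by simp
  moreover have "is_pole (pull 2) 0" by (intro pull_is_pole_0) simp
  ultimately show ?thesis
    by (intro differential_equation_unique[OF _ pull_meromorphic])
qed

lemma val_cube_root_of_unity:
  assumes "a ^ 3 = 1" shows "val (a * z) = val z"
proof -
  have a: "a \<noteq> 0" using assms by auto
  note ev = pull_cube_root_of_unity[OF assms, of z]
  show ?thesis
  proof (cases "val z")
    case None
    hence "is_pole (pull a) z" using val_None is_pole_cong[OF ev refl] by blast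
    thus ?thesis using None pull_is_pole[OF a] by simp
  next
    case (Some u)
    hence "pull a \<midarrow>z\<rightarrow> u" using val_Some tendsto_cong[OF ev] by blast
    thus ?thesis using Some pull_tendsto[OF a] by simp
  qed
qed

lemma val_minus: "val z = Some u \<Longrightarrow> val (- z) = Some (1 - u)"
proof -
  assume "val z = Some u"
  from tendsto_diff[OF tendsto_const val_Some[OF this]]
  have "(\<lambda>w. 1 - pull 1 w) \<midarrow>z\<rightarrow> 1 - u" .
  hence "pull (- 1) \<midarrow>z\<rightarrow> 1 - u" using tendsto_cong[OF pull_minus] by blast
  thus ?thesis using pull_tendsto[where a = "- 1" and z = z] by simp
qed

lemma val_double:
  assumes "val z = Some u" "2 * u \<noteq> 1" shows "val (2 * z) = Some (doubling u)"
proof -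
  have "((\<lambda>w. doubling (pull 1 w)) \<longlongrightarrow> doubling u) (at z)"
    unfolding doubling_def using assms(2)
    by (intro tendsto_intros val_Some[OF assms(1)]) simp
  hence "pull 2 \<midarrow>z\<rightarrow> doubling u" using tendsto_cong[OF pull_double] by blast
  thus ?thesis using pull_tendsto[where a = 2 and z = z] by simp
qed

lemma val_double_half:
  assumes "val z = Some (1 / 2)" shows "val (2 * z) = None"
proof -
  have "\<forall>\<^sub>F w in at (q + 1 * z). f w \<noteq> 1 / 2" by (rule eventually_neq)
  hence "\<forall>\<^sub>F w in at z. pull 1 w \<noteq> 1 / 2"
    unfolding filtermap_affine_at[OF one_neq_zero, symmetric] eventually_filtermap by (simp add: pull_def)
  hence "is_pole (\<lambda>w. doubling (pull 1 w)) z"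
    by (rule is_pole_doubling_half[OF val_Some[OF assms]])
  hence "is_pole (pull 2) z" using is_pole_cong[OF pull_double refl] by blast
  thus ?thesis using pull_is_pole[of 2 z] by simp
qed

end
end

section \<open>Torsion points of order dividing 3 and 6\<close>

lemma cube_root_of_unity_sum:
  fixes \<epsilon> :: complex
  assumes "\<epsilon> ^ 3 = 1" "\<epsilon> \<noteq> 1"
  shows "\<epsilon> ^ 2 + \<epsilon> + 1 = 0"
proof -
  have "(\<epsilon> - 1) * (\<epsilon> ^ 2 + \<epsilon> + 1) = 0"
    using assms(1) by (simp add: algebra_simps power2_eq_square power3_eq_cube)
  thus ?thesis using assms(2) by simp
qed

context equianharmonic
begin

context
  fixes q \<epsilon> :: complex
  assumes q: "is_pole f q" and eps: "\<epsilon> ^ 3 = 1" "\<epsilon> \<noteq> 1"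
begin

lemma eps_sum: "\<epsilon> ^ 2 = - 1 - \<epsilon>"
  using cube_root_of_unity_sum[OF eps] by (simp add: algebra_simps eq_neg_iff_add_eq_0)

lemma val_periodic: "l \<in> \<Lambda> \<Longrightarrow> val q (z + l) = val q z"
  using proj_value_periodic[of l "q + z"] by (simp add: val_def[OF q] add.assoc)

lemma val_special_unique:
  "val q a \<in> special_points \<Longrightarrow> val q b = val q a \<Longrightarrow> b - a \<in> \<Lambda>"
  using special_value_unique[of "q + a" "q + b"] by (simp add: val_def[OF q])

text \<open>Infinity is a special value, so its fibre is the single class of \<open>q\<close>.
  Membership in the lattice thus becomes a statement about values.\<close>

lemma val_eq_None_iff: "val q z = None \<longleftrightarrow> z \<in> \<Lambda>"
proof -
  have "val q 0 = None" using q by (simp add: val_def[OF q] proj_value_def)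
  thus ?thesis
    using val_periodic[of z 0] val_special_unique[of 0 z] by (auto simp: special_points_def)
qed

text \<open>\<open>\<Lambda>\<close> is the set of poles relative to \<open>q\<close>, so it
  inherits the symmetry of \<open>f\<close>.\<close>

lemma \<Lambda>_eps: "l \<in> \<Lambda> \<Longrightarrow> \<epsilon> * l \<in> \<Lambda>"
  using val_cube_root_of_unity[OF q eps(1), of l] val_eq_None_iff by metis

text \<open>The factors 2 + \<epsilon> and 2 + \<epsilon>^2 are Eisenstein integers of norm 3: (2 +
  \<epsilon>) * (1 - \<epsilon>) = 3 and (2 + \<epsilon>^2) * (2 + \<epsilon>) = 3.\<close>

lemma three_times_from_norm:
  assumes "x * z \<in> \<Lambda>" "x \<in> {3, 2 + \<epsilon>, 2 + \<epsilon> ^ 2}"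
  shows "3 * z \<in> \<Lambda>"
proof -
  have e: "\<epsilon> * \<epsilon> = - 1 - \<epsilon>" using eps_sum by (simp add: power2_eq_square)
  consider "x = 3" | "x = 2 + \<epsilon>" | "x = 2 + \<epsilon> ^ 2" using assms(2) by blast
  thus ?thesis
  proof cases
    case 1 thus ?thesis using assms by simp
  next
    case 2
    have "x * z - \<epsilon> * (x * z) \<in> \<Lambda>" using assms(1) by (intro \<Lambda>_diff \<Lambda>_eps)
    also have "x * z - \<epsilon> * (x * z) = (2 - \<epsilon> - \<epsilon> * \<epsilon>) * z" unfolding 2 by (simp add: algebra_simps)
    finally show ?thesis unfolding e by simp
  next
    case 3
    have "(x * z + x * z) + \<epsilon> * (x * z) \<in> \<Lambda>" using assms(1) by (intro \<Lambda>_add \<Lambda>_eps)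
    also have "(x * z + x * z) + \<epsilon> * (x * z) = (2 - \<epsilon> - \<epsilon> * \<epsilon>) * z"
      unfolding 3 eps_sum by (simp add: algebra_simps)
    finally show ?thesis unfolding e by simp
  qed
qed

text \<open>
  The fibre of \<open>f\<close> through \<open>- z\<close> is its orbit under \<open>\<epsilon>\<close>, so \<open>2 z = - \<epsilon>^j z\<close>, and \<open>2 + \<epsilon>^j\<close> divides \<open>3\<close>.  If
  the orbit degenerates, \<open>1 - \<epsilon>\<close> kills \<open>z\<close>, and it divides \<open>3\<close> as well.
\<close>

lemma three_torsion_of_equal_values:
  assumes v: "val q (2 * z) = val q (- z)" shows "3 * z \<in> \<Lambda>"
proof (cases "z - \<epsilon> * z \<in> \<Lambda>")
  case True
  \<comment> \<open>The norm of 1 - \<epsilon> is (1 - \<epsilon>) * (1 - \<epsilon>^2) = 3.\<close>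
  have "(z - \<epsilon> * z) - \<epsilon> * (\<epsilon> * (z - \<epsilon> * z)) \<in> \<Lambda>"
    by (rule \<Lambda>_diff[OF True \<Lambda>_eps[OF \<Lambda>_eps[OF True]]])
  also have "(z - \<epsilon> * z) - \<epsilon> * (\<epsilon> * (z - \<epsilon> * z)) = (1 - \<epsilon> - \<epsilon> ^ 2 + \<epsilon> ^ 3) * z"
    by (simp add: algebra_simps power2_eq_square power3_eq_cube)
  also have "\<dots> = 3 * z" unfolding eps_sum eps(1) by simp
  finally show ?thesis .
next
  case False
  have e3: "\<epsilon> * (\<epsilon> * (\<epsilon> * x)) = x" for x
    using eps(1) by (simp add: power3_eq_cube flip: mult.assoc)
  define a where "a = - z"
  \<comment> \<open>Multiplication by \<epsilon> preserves \<open>\<Lambda>\<close> and permutes the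
    three differences cyclically, so the first non-membership yields the other two.\<close>
  have n: "a - \<epsilon> * a \<notin> \<Lambda>" "\<epsilon> * a - \<epsilon> * (\<epsilon> * a) \<notin> \<Lambda>" "\<epsilon> * (\<epsilon> * a) - a \<notin> \<Lambda>"
  proof -
    show *: "a - \<epsilon> * a \<notin> \<Lambda>"
      using False \<Lambda>_minus[of "a - \<epsilon> * a"] by (auto simp: a_def)
    show "\<epsilon> * a - \<epsilon> * (\<epsilon> * a) \<notin> \<Lambda>"
    proof
      assume "\<epsilon> * a - \<epsilon> * (\<epsilon> * a) \<in> \<Lambda>"
      from \<Lambda>_eps[OF \<Lambda>_eps[OF this]] show False
        using * by (simp add: right_diff_distrib e3)
    qed
    show "\<epsilon> * (\<epsilon> * a) - a \<notin> \<Lambda>"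
    proof
      assume "\<epsilon> * (\<epsilon> * a) - a \<in> \<Lambda>"
      from \<Lambda>_eps[OF this] show False
        using * by (simp add: right_diff_distrib e3)
    qed
  qed
  have v': "val q (2 * z) = val q a" using v by (simp add: a_def)
  have w: "proj_value f (q + a) = val q a" "proj_value f (q + \<epsilon> * a) = val q a"
    "proj_value f (q + \<epsilon> * (\<epsilon> * a)) = val q a" "proj_value f (q + 2 * z) = val q a"
    using val_cube_root_of_unity[OF q eps(1)] v' by (simp_all flip: val_def[OF q])
  have "2 * z - a \<in> \<Lambda> \<or> 2 * z - \<epsilon> * a \<in> \<Lambda> \<or> 2 * z - \<epsilon> * (\<epsilon> * a) \<in> \<Lambda>"
    using fibre_cover[OF w] n by simp
  hence "3 * z \<in> \<Lambda> \<or> (2 + \<epsilon>) * z \<in> \<Lambda> \<or> (2 + \<epsilon> ^ 2) * z \<in> \<Lambda>"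
    by (simp add: a_def algebra_simps power2_eq_square)
  thus ?thesis using three_times_from_norm by blast
qed

text \<open>Cleared of denominators, R(u) = 1 - u becomes 9 u (u - 1) (u^2 - u + 1) = 0, and -
  \<epsilon>, - \<epsilon>^2 are the roots of the quadratic factor. The value 1/2 is impossible,
  since it would make 2 z a pole while - z is none.\<close>

lemma three_torsion_iff:
  "3 * z \<in> \<Lambda> \<longleftrightarrow> val q z \<in> {None, Some 0, Some 1, Some (- \<epsilon>), Some (- (\<epsilon> ^ 2))}"
proof
  assume z3: "3 * z \<in> \<Lambda>"
  have v2: "val q (2 * z) = val q (- z)" using val_periodic[OF z3, of "- z"] by simp
  show "val q z \<in> {None, Some 0, Some 1, Some (- \<epsilon>), Some (- (\<epsilon> ^ 2))}"
  proof (cases "val q z")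
    case (Some u)
    have m: "val q (- z) = Some (1 - u)" using val_minus[OF q Some] .
    have u: "2 * u \<noteq> 1"
    proof
      assume "2 * u = 1"
      hence "u = 1 / 2" by (simp add: field_simps)
      hence "val q (2 * z) = None" using val_double_half[OF q] Some by simp
      thus False using v2 m by simp
    qed
    have "doubling u = 1 - u" using val_double[OF q Some u] v2 m by simp
    hence "(u + 1) ^ 3 * (u - 1) = (1 - u) * (2 * u - 1) ^ 3" using doubling_eq_iff[OF u] by blast
    moreover have "(u + 1) ^ 3 * (u - 1) - (1 - u) * (2 * u - 1) ^ 3 = 9 * u * (u - 1) * (u ^ 2 - u + 1)"
      by algebra
    moreover have "u ^ 2 - u + 1 = (u + \<epsilon>) * (u + \<epsilon> ^ 2)"
      using eps_sum eps(1) by algebra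
    ultimately have "u = 0 \<or> u - 1 = 0 \<or> u + \<epsilon> = 0 \<or> u + \<epsilon> ^ 2 = 0" by simp
    thus ?thesis using Some by (auto simp: eq_neg_iff_add_eq_0)
  qed simp
next
  assume "val q z \<in> {None, Some 0, Some 1, Some (- \<epsilon>), Some (- (\<epsilon> ^ 2))}"
  then consider "val q z = None" | u where "val q z = Some u" "u \<in> {0, 1, - \<epsilon>, - (\<epsilon> ^ 2)}"
    by auto
  thus "3 * z \<in> \<Lambda>"
  proof cases
    case 1
    hence "z \<in> \<Lambda>" by (simp add: val_eq_None_iff)
    hence "z + z + z \<in> \<Lambda>" by (intro \<Lambda>_add)
    thus ?thesis by (simp add: algebra_simps)
  next
    case 2
    have "u ^ 2 - u + 1 = (u + \<epsilon>) * (u + \<epsilon> ^ 2)"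
      using eps_sum eps(1) by algebra
    hence e: "u * (u - 1) * (u ^ 2 - u + 1) = 0" using 2(2) by auto
    have u: "2 * u \<noteq> 1"
    proof
      assume "2 * u = 1"
      hence half: "u = 1 / 2" by (simp add: field_simps)
      show False using e unfolding half by (simp add: power2_eq_square)
    qed
    have "(u + 1) ^ 3 * (u - 1) = (1 - u) * (2 * u - 1) ^ 3"
      using e by algebra
    hence "doubling u = 1 - u" using doubling_eq_iff[OF u] by blast
    hence "val q (2 * z) = val q (- z)" using val_double[OF q 2(1) u] val_minus[OF q 2(1)] by simp
    thus ?thesis by (rule three_torsion_of_equal_values)
  qed
qed

text \<open>This is \<open>three_torsion_iff\<close> at 2 z. The alternative 2 u = 1 stands for the
  case in which 2 z is the pole.\<close>

lemma six_torsion_iff: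
  "6 * z \<in> \<Lambda> \<longleftrightarrow> (case val q z of None \<Rightarrow> True
     | Some u \<Rightarrow> 2 * u = 1 \<or> doubling u \<in> {0, 1, - \<epsilon>, - (\<epsilon> ^ 2)})"
proof -
  have "6 * z \<in> \<Lambda> \<longleftrightarrow> 3 * (2 * z) \<in> \<Lambda>" by simp
  also have "\<dots> \<longleftrightarrow> val q (2 * z) \<in> {None, Some 0, Some 1, Some (- \<epsilon>), Some (- (\<epsilon> ^ 2))}"
    by (rule three_torsion_iff)
  also have "\<dots> \<longleftrightarrow> (case val q z of None \<Rightarrow> True
     | Some u \<Rightarrow> 2 * u = 1 \<or> doubling u \<in> {0, 1, - \<epsilon>, - (\<epsilon> ^ 2)})"
  proof (cases "val q z")
    case None
    hence "z \<in> \<Lambda>" by (simp add: val_eq_None_iff)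
    hence "z + z \<in> \<Lambda>" by (intro \<Lambda>_add)
    hence "val q (2 * z) = None" by (simp add: val_eq_None_iff)
    thus ?thesis using None by simp
  next
    case (Some u)
    show ?thesis
    proof (cases "2 * u = 1")
      case True
      hence "u = 1 / 2" by (simp add: field_simps)
      hence half: "val q z = Some (1 / 2)" using Some by simp
      show ?thesis using val_double_half[OF q half] Some True by simp
    next
      case False
      thus ?thesis using val_double[OF q Some] Some by simp
    qed
  qed
  finally show ?thesis .
qed

lemma torsion_reps_origin:
  assumes p: "ram_index f p = 3" and n: "3 dvd n"
  shows "torsion_reps \<Lambda> p n = torsion_reps \<Lambda> q n"
proof -
  have "val q (p - q) \<in> special_points"
    using ram_index_3_special[OF p] by (simp add: val_def[OF q])
  hence pq: "3 * (p - q) \<in> \<Lambda>" unfolding three_torsion_iff by (auto simp: special_points_def)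
  have mult: "of_nat k * l \<in> \<Lambda>" if "l \<in> \<Lambda>" for k l
    by (induction k) (auto simp: distrib_right \<Lambda>_zero intro: \<Lambda>_add that)
  obtain k where k: "n = 3 * k" using n by blast
  define d where "d = of_nat k * (3 * (p - q))"
  have d: "d \<in> \<Lambda>" unfolding d_def using pq by (rule mult)
  have e: "of_nat n * (z - q) = of_nat n * (z - p) + d" for z
    unfolding d_def k by (simp add: algebra_simps)
  show ?thesis
  proof (rule set_eqI)
    fix z
    have "of_nat n * (z - p) \<in> \<Lambda> \<longleftrightarrow> of_nat n * (z - q) \<in> \<Lambda>"
    proof
      assume "of_nat n * (z - p) \<in> \<Lambda>"
      thus "of_nat n * (z - q) \<in> \<Lambda>" unfolding e using d by (rule \<Lambda>_add)
    next
      assume "of_nat n * (z - q) \<in> \<Lambda>"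
      hence "of_nat n * (z - q) - d \<in> \<Lambda>" using d by (rule \<Lambda>_diff)
      thus "of_nat n * (z - p) \<in> \<Lambda>" unfolding e by simp
    qed
    thus "z \<in> torsion_reps \<Lambda> p n \<longleftrightarrow> z \<in> torsion_reps \<Lambda> q n" by (simp add: torsion_reps_def)
  qed
qed

lemma proj_torsion_eq:
  assumes "ram_index f p = 3" "3 dvd n"
  shows "proj_torsion \<Lambda> f p n = {val q z | z. of_nat n * z \<in> \<Lambda>} - special_points"
proof -
  have "proj_value f ` torsion_reps \<Lambda> q n = {val q z | z. of_nat n * z \<in> \<Lambda>}"
  proof safe
    fix z assume "z \<in> torsion_reps \<Lambda> q n"
    thus "\<exists>y. proj_value f z = val q y \<and> of_nat n * y \<in> \<Lambda>"
      by (intro exI[of _ "z - q"]) (simp add: torsion_reps_def val_def[OF q])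
  next
    fix z assume "of_nat n * z \<in> \<Lambda>"
    thus "val q z \<in> proj_value f ` torsion_reps \<Lambda> q n"
      by (intro image_eqI[of _ _ "q + z"]) (simp_all add: torsion_reps_def val_def[OF q])
  qed
  thus ?thesis unfolding proj_torsion_def torsion_reps_origin[OF assms] by simp
qed

lemma surj_val: "\<exists>z. val q z = v"
proof -
  obtain y where "proj_value f y = v" using surj_proj_value by blast
  thus ?thesis by (intro exI[of _ "y - q"]) (simp add: val_def[OF q])
qed

lemma proj_torsion_3:
  assumes "ram_index f p = 3"
  shows "proj_torsion \<Lambda> f p 3 = Some ` {- \<epsilon>, - (\<epsilon> ^ 2)}"
proof -
  have val_range: "{val q z | z. val q z \<in> S} = S" for S
  proof (intro equalityI subsetI)
    fix v assume "v \<in> S"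
    moreover obtain z where "val q z = v" using surj_val by blast
    ultimately show "v \<in> {val q z | z. val q z \<in> S}" by blast
  qed blast
  have "\<epsilon> \<noteq> 0" "\<epsilon> \<noteq> - 1" "\<epsilon> ^ 2 \<noteq> 0" using eps by auto
  hence n: "- \<epsilon> \<notin> {0, 1}" "- (\<epsilon> ^ 2) \<notin> {0, 1}"
    using eps_sum eq_neg_iff_add_eq_0[of \<epsilon> 1] by (auto simp: minus_equation_iff[of \<epsilon>])
  have "{val q z | z. of_nat 3 * z \<in> \<Lambda>} = {None, Some 0, Some 1, Some (- \<epsilon>), Some (- (\<epsilon> ^ 2))}"
    unfolding of_nat_numeral three_torsion_iff by (rule val_range)
  thus ?thesis unfolding proj_torsion_eq[OF assms dvd_refl] using n
    by (auto simp: special_points_def)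
qed

lemma proj_torsion_6:
  assumes "ram_index f p = 3"
  shows "proj_torsion \<Lambda> f p 6 =
    Some ` {u. u \<noteq> 0 \<and> u \<noteq> 1 \<and> (2 * u = 1 \<or> doubling u \<in> {0, 1, - \<epsilon>, - (\<epsilon> ^ 2)})}"
    (is "_ = Some ` ?U")
proof -
  have "proj_torsion \<Lambda> f p 6 = {val q z | z. 6 * z \<in> \<Lambda>} - special_points"
    using proj_torsion_eq[OF assms, of 6] by simp
  also have "\<dots> = Some ` ?U"
  proof (intro equalityI subsetI)
    fix v assume "v \<in> {val q z | z. 6 * z \<in> \<Lambda>} - special_points"
    then obtain z where z: "v = val q z" "6 * z \<in> \<Lambda>" "val q z \<notin> special_points" by blast
    from z(3) obtain u where u: "val q z = Some u" "u \<noteq> 0" "u \<noteq> 1"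
      by (cases "val q z") (auto simp: special_points_def)
    have "u \<in> ?U" using z(2) u(2,3) unfolding six_torsion_iff u(1) by simp
    thus "v \<in> Some ` ?U" using z(1) u(1) by blast
  next
    fix v assume "v \<in> Some ` ?U"
    then obtain u where u: "v = Some u" "u \<in> ?U" by blast
    obtain z where z: "val q z = Some u" using surj_val by blast
    have "6 * z \<in> \<Lambda>" unfolding six_torsion_iff z using u(2) by simp
    thus "v \<in> {val q z | z. 6 * z \<in> \<Lambda>} - special_points"
      using u z by (auto simp: special_points_def intro!: exI[of _ z])
  qed
  finally show ?thesis .
qed

end
end

section \<open>Members of the pencils\<close>

text \<open>With the parameter given as a fraction n / d, what remains is a polynomial identity.
  Taking s = 2 suits the cubics written with b^2, where k contains a factor b and b^3 = 2
  applies.\<close>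

lemma proportional_memberI:
  assumes "d * u = n" "d \<noteq> 0" "s \<noteq> 0" "k \<noteq> 0"
    and "\<And>x y z. s * (d * pencil_zero \<epsilon> t x y z + n * pencil_infinity \<epsilon> t x y z) = k * G x y z"
  shows "proportional (pencil_member \<epsilon> t (Some u)) G"
  unfolding proportional_def
proof (intro exI[of _ "k / (s * d)"] conjI allI)
  show "k / (s * d) \<noteq> 0" using assms by simp
  fix x y z
  have "s * d * pencil_member \<epsilon> t (Some u) x y z = k * G x y z"
    using assms(5)[of x y z] by (simp add: algebra_simps flip: assms(1))
  thus "pencil_member \<epsilon> t (Some u) x y z = k / (s * d) * G x y z"
    using assms(2,3) by (simp add: field_simps)
qed

text \<open>
  The members of the pencils \<open>h\<close>, \<open>\<delta>\<close> and \<open>\<gamma>\<close> have this shape, with \<open>\<rho>\<close> equal to \<open>1\<close>, \<open>\<epsilon>^2\<close>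
  and \<open>\<epsilon>\<close> respectively.
\<close>

definition cyclic_form :: "complex \<Rightarrow> complex \<Rightarrow> complex \<Rightarrow> ternary_form" where
  "cyclic_form \<rho> A B x y z =
     A * (x^2 * y + \<rho> * y^2 * z + \<rho>^2 * x * z^2) + B * (x * y^2 + \<rho> * x^2 * z + \<rho>^2 * y * z^2)"

text \<open>Points with one coordinate 0 and the others 1 or - 1 separate the coefficients; \<rho>
  is then read off whichever of \<open>A\<close>, \<open>B\<close> is nonzero.\<close>

lemma cyclic_form_inject:
  assumes eq: "\<And>x y z. cyclic_form \<rho> A B x y z = c * cyclic_form \<rho>' A' B' x y z"
    and nz: "A \<noteq> 0 \<or> B \<noteq> 0"
  shows "A = c * A'" "B = c * B'" "\<rho> = \<rho>'"
proof -
  have A: "A = c * A'" and B: "B = c * B'"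
    using eq[of 1 1 0] eq[of 1 "- 1" 0] by (simp_all add: cyclic_form_def algebra_simps) algebra+
  have "\<rho> * A = \<rho>' * (c * A')"
    using eq[of 0 1 1] eq[of 0 1 "- 1"] by (simp add: cyclic_form_def) algebra
  moreover have "\<rho> * B = \<rho>' * (c * B')"
    using eq[of 1 0 1] eq[of 1 0 "- 1"] by (simp add: cyclic_form_def) algebra
  ultimately show "\<rho> = \<rho>'" using nz unfolding A B by auto
  show "A = c * A'" "B = c * B'" by (fact A B)+
qed

context
  fixes \<epsilon> :: complex
  assumes eps: "\<epsilon> ^ 3 = 1" "\<epsilon> \<noteq> 1"
begin

text \<open>Reduction to the basis 1, \<epsilon>. The second form reaches squares of \<epsilon>
  inside products associated to the right.\<close>

lemma eps_rules: "\<epsilon> * \<epsilon> = - 1 - \<epsilon>" "\<epsilon> * (\<epsilon> * X) = - X - \<epsilon> * X"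
proof -
  show *: "\<epsilon> * \<epsilon> = - 1 - \<epsilon>"
    using cube_root_of_unity_sum[OF eps] by algebra
  show "\<epsilon> * (\<epsilon> * X) = - X - \<epsilon> * X" unfolding mult.assoc[symmetric] * by (simp add: algebra_simps)
qed

lemma member_cyclic_form:
  "pencil_member \<epsilon> Pencil_h (Some u) = cyclic_form 1 (- (1 + \<epsilon> * u)) (1 + \<epsilon> ^ 2 * u)"
  "pencil_member \<epsilon> Pencil_delta (Some u) = cyclic_form (\<epsilon> ^ 2) (- (1 + \<epsilon> * u)) (\<epsilon> + u)"
  "pencil_member \<epsilon> Pencil_gamma (Some u) = cyclic_form \<epsilon> (- (1 + \<epsilon> * u)) (1 + \<epsilon> ^ 2 * u)"
  by (intro ext; simp add: cyclic_form_def algebra_simps power2_eq_square eps_rules)+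

lemma eps_neq: "\<epsilon> \<noteq> 0" "\<epsilon> ^ 2 \<noteq> 1" "\<epsilon> ^ 2 \<noteq> \<epsilon>"
  using eps by (auto simp: power3_eq_cube power2_eq_square)

text \<open>A cyclic form contains no pure cubes, but z^3 has coefficient 1 in these
  members.\<close>

lemma member_v_not_cyclic:
  assumes "\<And>x y z. pencil_member \<epsilon> Pencil_v (Some u) x y z = c * cyclic_form \<rho> A B x y z"
  shows False
  using assms[of 0 0 1] by (simp add: cyclic_form_def)

lemma cyclic_coefficients_nonzero:
  "- (1 + \<epsilon> * u) \<noteq> 0 \<or> 1 + \<epsilon> ^ 2 * u \<noteq> 0" "- (1 + \<epsilon> * u) \<noteq> 0 \<or> \<epsilon> + u \<noteq> 0"
proof -
  have "1 - \<epsilon> = 0" if "1 + \<epsilon> * u = 0" "1 + \<epsilon> ^ 2 * u = 0"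
    using that by algebra
  moreover have "\<epsilon> ^ 2 - 1 = 0" if "1 + \<epsilon> * u = 0" "\<epsilon> + u = 0"
    using that by algebra
  ultimately show "- (1 + \<epsilon> * u) \<noteq> 0 \<or> 1 + \<epsilon> ^ 2 * u \<noteq> 0" "- (1 + \<epsilon> * u) \<noteq> 0 \<or> \<epsilon> + u \<noteq> 0"
    using eps(2) eps_neq(2) unfolding neg_equal_0_iff_equal right_minus_eq by blast+
qed

lemma cyclic_coefficients_inject:
  "1 + \<epsilon> * u = c * (1 + \<epsilon> * u') \<Longrightarrow> 1 + \<epsilon> ^ 2 * u = c * (1 + \<epsilon> ^ 2 * u') \<Longrightarrow> c \<noteq> 0 \<Longrightarrow> u = u'"
  "1 + \<epsilon> * u = c * (1 + \<epsilon> * u') \<Longrightarrow> \<epsilon> + u = c * (\<epsilon> + u') \<Longrightarrow> c \<noteq> 0 \<Longrightarrow> u = u'"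
proof -
  assume h: "1 + \<epsilon> * u = c * (1 + \<epsilon> * u')" "1 + \<epsilon> ^ 2 * u = c * (1 + \<epsilon> ^ 2 * u')" "c \<noteq> 0"
  have "c * ((\<epsilon> ^ 2 - \<epsilon>) * (u - u')) = 0" using h(1,2) by algebra
  thus "u = u'" using h(3) eps_neq by simp
next
  assume h: "1 + \<epsilon> * u = c * (1 + \<epsilon> * u')" "\<epsilon> + u = c * (\<epsilon> + u')" "c \<noteq> 0"
  have "c * ((\<epsilon> ^ 2 - 1) * (u - u')) = 0" using h(1,2) by algebra
  thus "u = u'" using h(3) eps_neq by simp
qed

text \<open>Pure cubes single out \<open>Pencil_v\<close>, the invariant \<rho> separates the other
  three pencils, and the ratio of the two coefficients of the cyclic form determines the
  parameter.\<close>

lemma member_proportional_inject: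
  assumes "proportional (pencil_member \<epsilon> t (Some u)) (pencil_member \<epsilon> t' (Some u'))"
  shows "t = t' \<and> u = u'"
proof -
  obtain c where c: "c \<noteq> 0"
    and eq: "\<And>x y z. pencil_member \<epsilon> t (Some u) x y z = c * pencil_member \<epsilon> t' (Some u') x y z"
    using assms unfolding proportional_def by blast
  have eq': "pencil_member \<epsilon> t' (Some u') x y z = inverse c * pencil_member \<epsilon> t (Some u) x y z" for x y z
    using eq[of x y z] c by simp
  show ?thesis
  proof (cases "t = Pencil_v \<or> t' = Pencil_v")
    case True
    have "t = Pencil_v \<and> t' = Pencil_v"
    proof (rule ccontr)
      assume "\<not> ?thesis"
      with True consider "t = Pencil_v" "t' \<noteq> Pencil_v" | "t' = Pencil_v" "t \<noteq> Pencil_v" by blast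
      thus False
      proof cases
        case 1
        show False using eq member_v_not_cyclic 1
          by (cases t') (simp_all only: member_cyclic_form, blast+)
      next
        case 2
        show False using eq' member_v_not_cyclic 2
          by (cases t) (simp_all only: member_cyclic_form, blast+)
      qed
    qed
    thus ?thesis using eq[of 0 0 1] eq[of 1 0 0] by auto
  next
    case False
    hence t: "t \<in> {Pencil_h, Pencil_delta, Pencil_gamma}" "t' \<in> {Pencil_h, Pencil_delta, Pencil_gamma}"
      by (cases t; cases t'; simp)+
    define \<rho> where "\<rho> = (\<lambda>t. if t = Pencil_h then 1 else if t = Pencil_delta then \<epsilon> ^ 2 else \<epsilon>)"
    define B where "B = (\<lambda>t u. if t = Pencil_delta then \<epsilon> + u else 1 + \<epsilon> ^ 2 * u)"
    have form: "pencil_member \<epsilon> t (Some u) = cyclic_form (\<rho> t) (- (1 + \<epsilon> * u)) (B t u)"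
      if "t \<in> {Pencil_h, Pencil_delta, Pencil_gamma}" for t u
      using that by (auto simp: member_cyclic_form \<rho>_def B_def)
    have nz: "- (1 + \<epsilon> * u) \<noteq> 0 \<or> B t u \<noteq> 0"
      using cyclic_coefficients_nonzero[of u] by (auto simp: B_def)
    have eqf: "cyclic_form (\<rho> t) (- (1 + \<epsilon> * u)) (B t u) x y z =
        c * cyclic_form (\<rho> t') (- (1 + \<epsilon> * u')) (B t' u') x y z" for x y z
      using eq[of x y z] unfolding form[OF t(1)] form[OF t(2)] .
    note inj = cyclic_form_inject[OF eqf nz]
    have "t = t'" using inj(3) t eps_neq eps(2) by (auto simp: \<rho>_def)
    moreover have "1 + \<epsilon> * u = c * (1 + \<epsilon> * u')" using inj(1) by algebra
    hence "u = u'" using inj(2) c cyclic_coefficients_inject[of u c u'] \<open>t = t'\<close>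
      by (auto simp: B_def split: if_splits)
    ultimately show ?thesis by blast
  qed
qed

lemma plane_curve_member_inject:
  assumes "plane_curve (pencil_member \<epsilon> t (Some u)) = plane_curve (pencil_member \<epsilon> t' (Some u'))"
  shows "t = t' \<and> u = u'"
proof -
  have "pencil_member \<epsilon> t (Some u) \<in> plane_curve (pencil_member \<epsilon> t (Some u))"
    by (auto simp: plane_curve_def proportional_def intro: exI[of _ 1])
  hence "proportional (pencil_member \<epsilon> t (Some u)) (pencil_member \<epsilon> t' (Some u'))"
    unfolding assms by (simp add: plane_curve_def)
  thus ?thesis by (rule member_proportional_inject)
qed

end

lemma card_pencil: "card (UNIV :: pencil set) = 4"
proof -
  have *: "(UNIV :: pencil set) = {Pencil_v, Pencil_h, Pencil_delta, Pencil_gamma}"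
    using pencil.exhaust by auto
  show ?thesis unfolding * by simp
qed

section \<open>The nine parameters\<close>

lemma cube_eq_iff:
  fixes \<epsilon> x d :: complex
  assumes "\<epsilon> ^ 3 = 1" "\<epsilon> \<noteq> 1"
  shows "x ^ 3 = d ^ 3 \<longleftrightarrow> x \<in> {d, \<epsilon> * d, \<epsilon> ^ 2 * d}"
proof -
  have "x ^ 3 - d ^ 3 = (x - d) * ((x - \<epsilon> * d) * (x - \<epsilon> ^ 2 * d))"
    using assms(1) cube_root_of_unity_sum[OF assms] by algebra
  moreover have "x ^ 3 = d ^ 3 \<longleftrightarrow> x ^ 3 - d ^ 3 = 0" by simp
  ultimately show ?thesis by auto
qed

text \<open>
  The inverse of \<open>moebius \<epsilon>\<close> is \<open>u \<mapsto> (u + \<epsilon>) / (1 + \<epsilon> * u)\<close>.  It sends \<open>- \<epsilon>\<close> and \<open>- \<epsilon>^2\<close>, the values at the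
  points of order \<open>3\<close>, to \<open>0\<close> and \<open>\<infinity>\<close>, and thereby turns the equations of the remaining values at
  \<open>6\<close>-torsion points into \<open>x^3 = c\<close> with \<open>c\<close> equal to \<open>2\<close>, \<open>1/2\<close> or \<open>-1\<close>.
\<close>

definition moebius :: "complex \<Rightarrow> complex \<Rightarrow> complex" where
  "moebius \<epsilon> x = (\<epsilon> - x) / (x * \<epsilon> - 1)"

definition binomial_roots :: "complex set" where
  "binomial_roots = {x. x ^ 3 = 2} \<union> {x. x ^ 3 = 1 / 2} \<union> {x. x ^ 3 = - 1}"

text \<open>Nine is 11 - 2, the difference of 3 m^2 - 1 for m = 2 and m = 1. Together with
  \<open>inj_on_moebius\<close> this counts the parameters.\<close>

lemma card_binomial_roots: "card binomial_roots = 9" "finite binomial_roots"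
proof -
  define R where "R = (\<lambda>c::complex. {x. x ^ 3 = c})"
  have fin: "finite (R c)" for c
    unfolding R_def by (rule finite_nth_roots) simp
  have card: "card (R c) = 3" if "c \<noteq> 0" for c
    unfolding R_def using that by (intro card_nth_roots) simp_all
  have disj: "R c \<inter> R d = {}" if "c \<noteq> d" for c d
    using that by (auto simp: R_def)
  have roots: "binomial_roots = (R 2 \<union> R (1 / 2)) \<union> R (- 1)"
    by (simp only: binomial_roots_def R_def)
  show "finite binomial_roots" unfolding roots by (intro finite_UnI fin)
  have "card (R 2 \<union> R (1 / 2)) = 6"
    by (subst card_Un_disjoint) (simp_all add: card fin disj)
  thus "card binomial_roots = 9"
    unfolding roots by (subst card_Un_disjoint) (simp_all add: card fin disj Int_Un_distrib2)
qed

context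
  fixes \<epsilon> :: complex
  assumes eps: "\<epsilon> ^ 3 = 1" "\<epsilon> \<noteq> 1"
begin

lemma binomial_roots_denominator: "x \<in> binomial_roots \<Longrightarrow> x * \<epsilon> - 1 \<noteq> 0"
proof
  assume x: "x \<in> binomial_roots" "x * \<epsilon> - 1 = 0"
  hence "x ^ 3 * \<epsilon> ^ 3 = 1" by (simp flip: power_mult_distrib)
  thus False using x(1) eps(1) by (auto simp: binomial_roots_def)
qed

lemma inj_on_moebius: "inj_on (moebius \<epsilon>) binomial_roots"
proof (rule inj_onI)
  fix x y assume xy: "x \<in> binomial_roots" "y \<in> binomial_roots" "moebius \<epsilon> x = moebius \<epsilon> y"
  hence "(\<epsilon> - x) * (y * \<epsilon> - 1) = (\<epsilon> - y) * (x * \<epsilon> - 1)"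
    using binomial_roots_denominator by (simp add: moebius_def frac_eq_eq)
  hence "(\<epsilon> ^ 2 - 1) * (x - y) = 0" by algebra
  moreover have "\<epsilon> ^ 2 - 1 \<noteq> 0"
    using eps by (auto simp: power3_eq_cube power2_eq_square)
  ultimately show "x = y" by simp
qed

text \<open>With x = (u + \<epsilon>) / (1 + \<epsilon> * u) the cubic expressions vanish for x^3 =
  2, x^3 = 1/2 and x^3 = - 1. The linear factor in the first two is the value of order 3 that
  doubles to - \<epsilon>^2 or - \<epsilon>. The roots - 1, 1/2, 2 in the third double to 0,
  infinity, 1.\<close>

lemma six_torsion_factorization:
  fixes u :: complex
  shows "(u + 1) ^ 3 * (u - 1) + \<epsilon> ^ 2 * (2 * u - 1) ^ 3 =
      (u + \<epsilon>) * (2 * (1 + \<epsilon> * u) ^ 3 - (u + \<epsilon>) ^ 3)"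
    and "(u + 1) ^ 3 * (u - 1) + \<epsilon> * (2 * u - 1) ^ 3 =
      (u + \<epsilon> ^ 2) * (2 * (u + \<epsilon>) ^ 3 - (1 + \<epsilon> * u) ^ 3)"
    and "(u + \<epsilon>) ^ 3 + (1 + \<epsilon> * u) ^ 3 = (u + 1) * ((2 * u - 1) * (u - 2))"
  using eps(1) cube_root_of_unity_sum[OF eps] by algebra+

lemma moebius_eqI: "u * (x * \<epsilon> - 1) = \<epsilon> - x \<Longrightarrow> x * \<epsilon> - 1 \<noteq> 0 \<Longrightarrow> moebius \<epsilon> x = u"
  by (simp add: moebius_def divide_eq_eq)

lemma six_torsion_values:
  "{u. u \<noteq> 0 \<and> u \<noteq> 1 \<and> (2 * u = 1 \<or> doubling u \<in> {0, 1, - \<epsilon>, - (\<epsilon> ^ 2)})} - {- \<epsilon>, - (\<epsilon> ^ 2)}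
    = moebius \<epsilon> ` binomial_roots"
proof (intro equalityI subsetI)
  fix u assume "u \<in> {u. u \<noteq> 0 \<and> u \<noteq> 1 \<and>
    (2 * u = 1 \<or> doubling u \<in> {0, 1, - \<epsilon>, - (\<epsilon> ^ 2)})} - {- \<epsilon>, - (\<epsilon> ^ 2)}"
  hence u: "u \<noteq> 0" "u \<noteq> 1" "u + \<epsilon> \<noteq> 0" "u + \<epsilon> ^ 2 \<noteq> 0"
    and alt: "2 * u = 1 \<or> 2 * u \<noteq> 1 \<and> doubling u \<in> {0, 1, - \<epsilon>, - (\<epsilon> ^ 2)}"
    by (auto simp: eq_neg_iff_add_eq_0)
  have "\<epsilon> * (u + \<epsilon> ^ 2) = 1 + \<epsilon> * u" using eps(1) by algebra
  moreover have "\<epsilon> \<noteq> 0" using eps(1) by auto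
  ultimately have den: "1 + \<epsilon> * u \<noteq> 0" using u(4) by (metis mult_eq_0_iff)
  have cubes: "(u + \<epsilon>) ^ 3 = 2 * (1 + \<epsilon> * u) ^ 3 \<or> 2 * (u + \<epsilon>) ^ 3 = (1 + \<epsilon> * u) ^ 3 \<or>
      (u + \<epsilon>) ^ 3 + (1 + \<epsilon> * u) ^ 3 = 0"
  proof -
    consider "2 * u = 1" | "2 * u \<noteq> 1" "doubling u = 0" | "2 * u \<noteq> 1" "doubling u = 1"
      | "2 * u \<noteq> 1" "doubling u = - \<epsilon>" | "2 * u \<noteq> 1" "doubling u = - (\<epsilon> ^ 2)"
      using alt by auto
    thus ?thesis
    proof cases
      case 1
      thus ?thesis unfolding six_torsion_factorization(3) by simp
    next
      case 2
      hence "u + 1 = 0" using u(2) by (simp add: doubling_def)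
      thus ?thesis unfolding six_torsion_factorization(3) by simp
    next
      case 3
      hence "u - 2 = 0" using doubling_minus_1[of u] u(1) by simp
      thus ?thesis unfolding six_torsion_factorization(3) by simp
    next
      case 4
      hence "(u + 1) ^ 3 * (u - 1) + \<epsilon> * (2 * u - 1) ^ 3 = 0" by (simp add: doubling_eq_iff)
      thus ?thesis unfolding six_torsion_factorization(2) using u(4) by simp
    next
      case 5
      hence "(u + 1) ^ 3 * (u - 1) + \<epsilon> ^ 2 * (2 * u - 1) ^ 3 = 0" by (simp add: doubling_eq_iff)
      thus ?thesis unfolding six_torsion_factorization(1) using u(3) by simp
    qed
  qed
  define x where "x = (u + \<epsilon>) / (1 + \<epsilon> * u)"
  have x: "x * (1 + \<epsilon> * u) = u + \<epsilon>" using den by (simp add: x_def)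
  have "x ^ 3 = (u + \<epsilon>) ^ 3 / (1 + \<epsilon> * u) ^ 3" by (simp add: x_def power_divide)
  moreover have "X / Y = 2 \<or> X / Y = 1 / 2 \<or> X / Y = - 1"
    if "X = 2 * Y \<or> 2 * X = Y \<or> X + Y = 0" "Y \<noteq> 0" for X Y :: complex
    using that by (elim disjE) (auto simp: divide_simps add_eq_0_iff2)
  ultimately have "x \<in> binomial_roots"
    using cubes den unfolding binomial_roots_def by simp
  moreover have "u * (x * \<epsilon> - 1) = \<epsilon> - x" using x by algebra
  ultimately show "u \<in> moebius \<epsilon> ` binomial_roots"
    using moebius_eqI binomial_roots_denominator by (metis image_eqI)
next
  fix u assume "u \<in> moebius \<epsilon> ` binomial_roots"
  then obtain x where x: "x \<in> binomial_roots" "u = moebius \<epsilon> x" by blast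
  have d: "x * \<epsilon> - 1 \<noteq> 0" using binomial_roots_denominator[OF x(1)] .
  have "u * (x * \<epsilon> - 1) = \<epsilon> - x" using x(2) d by (simp add: moebius_def)
  hence ux: "u + \<epsilon> = x * (1 + \<epsilon> * u)" by algebra
  hence cube: "(u + \<epsilon>) ^ 3 = x ^ 3 * (1 + \<epsilon> * u) ^ 3" by (simp add: power_mult_distrib)
  have x3: "x ^ 3 = 2 \<or> x ^ 3 = 1 / 2 \<or> x ^ 3 = - 1" using x(1) by (auto simp: binomial_roots_def)
  have e: "\<epsilon> \<noteq> 0" "\<epsilon> + 1 \<noteq> 0" "\<epsilon> ^ 2 - 1 \<noteq> 0" "\<epsilon> ^ 2 - \<epsilon> \<noteq> 0"
  proof -
    show "\<epsilon> \<noteq> 0" using eps(1) by auto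
    have "(\<epsilon> + 1) * (- \<epsilon>) = 1" using cube_root_of_unity_sum[OF eps] by algebra
    thus "\<epsilon> + 1 \<noteq> 0" by auto
    show "\<epsilon> ^ 2 - 1 \<noteq> 0" "\<epsilon> ^ 2 - \<epsilon> \<noteq> 0"
      using eps by (auto simp: power3_eq_cube power2_eq_square)
  qed
  have "u \<noteq> 0"
  proof
    assume "u = 0"
    hence "x ^ 3 = 1" using cube eps(1) by simp
    thus False using x3 by auto
  qed
  moreover have "u \<noteq> 1"
  proof
    assume "u = 1"
    hence "x ^ 3 * (\<epsilon> + 1) ^ 3 = 1 * (\<epsilon> + 1) ^ 3" using cube by (simp add: add.commute)
    hence "x ^ 3 = 1" using e(2) by simp
    thus False using x3 by auto
  qed
  moreover have "u \<noteq> - \<epsilon>"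
  proof
    assume "u = - \<epsilon>"
    hence "x * (\<epsilon> ^ 2 - 1) = 0" using ux by algebra
    hence "x = 0" using e(3) by simp
    thus False using x3 by auto
  qed
  moreover have "u \<noteq> - (\<epsilon> ^ 2)"
  proof
    assume "u = - (\<epsilon> ^ 2)"
    hence "\<epsilon> ^ 2 - \<epsilon> = 0" using ux eps(1) by algebra
    thus False using e(4) by simp
  qed
  moreover have "2 * u = 1 \<or> doubling u \<in> {0, 1, - \<epsilon>, - (\<epsilon> ^ 2)}"
  proof (cases "2 * u = 1")
    case False
    consider "x ^ 3 = 2" | "x ^ 3 = 1 / 2" | "x ^ 3 = - 1" using x3 by blast
    hence "doubling u \<in> {0, 1, - \<epsilon>, - (\<epsilon> ^ 2)}"
    proof cases
      case 1
      hence "(u + 1) ^ 3 * (u - 1) + \<epsilon> ^ 2 * (2 * u - 1) ^ 3 = 0"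
        unfolding six_torsion_factorization(1) using cube by simp
      hence "(u + 1) ^ 3 * (u - 1) = - (\<epsilon> ^ 2) * (2 * u - 1) ^ 3" by (simp add: eq_neg_iff_add_eq_0)
      hence "doubling u = - (\<epsilon> ^ 2)" using doubling_eq_iff[OF False] by blast
      thus ?thesis by simp
    next
      case 2
      have "(u + 1) ^ 3 * (u - 1) + \<epsilon> * (2 * u - 1) ^ 3 = 0"
        unfolding six_torsion_factorization(2) cube 2 by simp
      hence "(u + 1) ^ 3 * (u - 1) = - \<epsilon> * (2 * u - 1) ^ 3" by (simp add: eq_neg_iff_add_eq_0)
      hence "doubling u = - \<epsilon>" using doubling_eq_iff[OF False] by blast
      thus ?thesis by simp
    next
      case 3
      hence "(u + 1) * ((2 * u - 1) * (u - 2)) = 0"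
        unfolding six_torsion_factorization(3)[symmetric] using cube by simp
      hence "u + 1 = 0 \<or> u = 2" using False by simp
      thus ?thesis by (auto simp: doubling_def)
    qed
    thus ?thesis ..
  qed simp
  ultimately show "u \<in> {u. u \<noteq> 0 \<and> u \<noteq> 1 \<and>
    (2 * u = 1 \<or> doubling u \<in> {0, 1, - \<epsilon>, - (\<epsilon> ^ 2)})} - {- \<epsilon>, - (\<epsilon> ^ 2)}" by simp
qed

text \<open>Each parameter is recorded as d * u = n. This form serves both the identification with
  \<open>moebius\<close> values and the first premise of
  \<open>proportional_memberI\<close>.\<close>

lemma six_parameter_products:
  assumes b: "b ^ 3 = 2" and tau: "\<tau> = - \<epsilon> * ((b * \<epsilon>^2 - 1) / (b * \<epsilon> - 1))"
  shows "(b * \<epsilon> - 1) * \<tau> = \<epsilon> - b"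
    and "(b - 1) * inverse (1 - \<tau>) = \<epsilon> - b * \<epsilon>^2"
    and "(b * \<epsilon>^2 - 1) * (1 - inverse \<tau>) = \<epsilon> - b * \<epsilon>"
    and "(\<epsilon> - b) * inverse \<tau> = b * \<epsilon> - 1"
    and "(\<epsilon> - b * \<epsilon>) * inverse (1 - inverse \<tau>) = b * \<epsilon>^2 - 1"
    and "(\<epsilon> - b * \<epsilon>^2) * (1 - \<tau>) = b - 1"
    and "b * \<epsilon> - 1 \<noteq> 0" "b - 1 \<noteq> 0" "b * \<epsilon>^2 - 1 \<noteq> 0"
      "\<epsilon> - b \<noteq> 0" "\<epsilon> - b * \<epsilon> \<noteq> 0" "\<epsilon> - b * \<epsilon>^2 \<noteq> 0"
proof -
  have e6: "\<epsilon> ^ 6 = 1" using eps(1) by algebra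
  \<comment> \<open>All cube roots of 2 differ from the cube roots of 1, which makes the
    denominators nonzero.\<close>
  have c1: "(b * \<epsilon>) ^ 3 = 2" "(b * \<epsilon> ^ 2) ^ 3 = 2"
    using b eps(1) e6 by (simp_all add: power_mult_distrib flip: power_mult)
  show n1: "b * \<epsilon> - 1 \<noteq> 0" and n2: "b - 1 \<noteq> 0" and n3: "b * \<epsilon>^2 - 1 \<noteq> 0" and n4: "\<epsilon> - b \<noteq> 0"
    using b c1 eps(1) by auto
  have e0: "\<epsilon> \<noteq> 0" using eps(1) by auto
  have "\<epsilon> - b * \<epsilon> = - \<epsilon> * (b - 1)" "\<epsilon> - b * \<epsilon>^2 = - \<epsilon> * (b * \<epsilon> - 1)" by algebra+
  thus "\<epsilon> - b * \<epsilon> \<noteq> 0" "\<epsilon> - b * \<epsilon>^2 \<noteq> 0" using e0 n1 n2 by simp_all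
  have "(b * \<epsilon> - 1) * \<tau> = - \<epsilon> * (b * \<epsilon>^2 - 1)" unfolding tau using n1 by simp
  thus t: "(b * \<epsilon> - 1) * \<tau> = \<epsilon> - b" using eps(1) by algebra
  have t0: "\<tau> \<noteq> 0" using t n4 by auto
  have t1: "(b * \<epsilon> - 1) * (1 - \<tau>) = - (\<epsilon> ^ 2) * (b - 1)" using t cube_root_of_unity_sum[OF eps] by algebra
  hence t1n: "1 - \<tau> \<noteq> 0" using n2 e0 by auto
  show s4: "(\<epsilon> - b) * inverse \<tau> = b * \<epsilon> - 1"
    unfolding t[symmetric] using t0 by simp
  show s6: "(\<epsilon> - b * \<epsilon>^2) * (1 - \<tau>) = b - 1" using t1 eps(1) by algebra
  have "(b - 1) * inverse (1 - \<tau>) = (\<epsilon> - b * \<epsilon>^2) * ((1 - \<tau>) * inverse (1 - \<tau>))"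
    unfolding s6[symmetric] by simp
  thus "(b - 1) * inverse (1 - \<tau>) = \<epsilon> - b * \<epsilon>^2" using t1n by simp
  define i where "i = inverse \<tau>"
  have "(\<epsilon> - b) * i = b * \<epsilon> - 1" using s4 by (simp add: i_def)
  hence s3: "(b * \<epsilon>^2 - 1) * (1 - i) = \<epsilon> - b * \<epsilon>" using eps(1) cube_root_of_unity_sum[OF eps] by algebra
  thus "(b * \<epsilon>^2 - 1) * (1 - inverse \<tau>) = \<epsilon> - b * \<epsilon>" by (simp add: i_def)
  have "1 - i \<noteq> 0" using s3 \<open>\<epsilon> - b * \<epsilon> \<noteq> 0\<close> by auto
  thus "(\<epsilon> - b * \<epsilon>) * inverse (1 - inverse \<tau>) = b * \<epsilon>^2 - 1"
    unfolding s3[symmetric] i_def by simp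
qed

text \<open>In the coordinate x, u \<mapsto> 1 - 1/u is multiplication by \<epsilon> and u \<mapsto>
  1/u is inversion. The six values obtained from \<tau>, which has x = b, are thus the cube roots of
  2 and 1/2, and the three obtained from - 1 are the cube roots of - 1.\<close>

lemma nine_values:
  assumes b: "b ^ 3 = 2" and tau: "\<tau> = - \<epsilon> * ((b * \<epsilon>^2 - 1) / (b * \<epsilon> - 1))"
  shows "moebius \<epsilon> ` binomial_roots = {\<tau>, inverse (1 - \<tau>), 1 - inverse \<tau>, inverse \<tau>,
               inverse (1 - inverse \<tau>), 1 - \<tau>, -1, 1/2, 2}"
proof -
  note P = six_parameter_products[OF b tau]
  have b0: "b \<noteq> 0" using b by auto
  have roots: "binomial_roots = {b, \<epsilon> * b, \<epsilon> ^ 2 * b, inverse b, \<epsilon> * inverse b, \<epsilon> ^ 2 * inverse b,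
      - 1, \<epsilon> * - 1, \<epsilon> ^ 2 * - 1}"
  proof -
    have "x ^ 3 = 2 \<longleftrightarrow> x \<in> {b, \<epsilon> * b, \<epsilon> ^ 2 * b}" for x
      using cube_eq_iff[OF eps, of x b] b by simp
    moreover have ib: "inverse b ^ 3 = 1 / 2" unfolding power_inverse b by simp
    have "x ^ 3 = 1 / 2 \<longleftrightarrow> x \<in> {inverse b, \<epsilon> * inverse b, \<epsilon> ^ 2 * inverse b}" for x
      using cube_eq_iff[OF eps, of x "inverse b"] unfolding ib .
    moreover have "x ^ 3 = - 1 \<longleftrightarrow> x \<in> {- 1, \<epsilon> * - 1, \<epsilon> ^ 2 * - 1}" for x
      using cube_eq_iff[OF eps, of x "- 1"] by simp
    ultimately show ?thesis unfolding binomial_roots_def by auto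
  qed
  have den: "x * \<epsilon> - 1 \<noteq> 0" if "x \<in> binomial_roots" for x
    by (rule binomial_roots_denominator[OF that])
  have bi: "b * inverse b = 1" using b0 by simp
  have "moebius \<epsilon> b = \<tau>"
    using P(1) den[of b] by (intro moebius_eqI) (simp_all add: roots mult.commute)
  moreover have "moebius \<epsilon> (\<epsilon> * b) = 1 - inverse \<tau>"
    using P(3) den[of "\<epsilon> * b"] by (intro moebius_eqI) (simp_all add: roots mult_ac power2_eq_square)
  moreover have "moebius \<epsilon> (\<epsilon> ^ 2 * b) = inverse (1 - \<tau>)"
  proof (intro moebius_eqI)
    have e3: "\<epsilon> ^ 2 * b * \<epsilon> = b" using eps(1) by algebra
    show "inverse (1 - \<tau>) * (\<epsilon> ^ 2 * b * \<epsilon> - 1) = \<epsilon> - \<epsilon> ^ 2 * b"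
      unfolding e3 using P(2) by (simp add: mult.commute)
    show "\<epsilon> ^ 2 * b * \<epsilon> - 1 \<noteq> 0" by (rule den) (simp add: roots)
  qed
  moreover have "moebius \<epsilon> (inverse b) = inverse \<tau>"
  proof (intro moebius_eqI)
    define i where "i = inverse \<tau>"
    have "(\<epsilon> - b) * i = b * \<epsilon> - 1" using P(4) by (simp add: i_def)
    hence "i * (inverse b * \<epsilon> - 1) = \<epsilon> - inverse b" using bi by algebra
    thus "inverse \<tau> * (inverse b * \<epsilon> - 1) = \<epsilon> - inverse b" by (simp add: i_def)
    show "inverse b * \<epsilon> - 1 \<noteq> 0" by (rule den) (simp add: roots)
  qed
  moreover have "moebius \<epsilon> (\<epsilon> * inverse b) = 1 - \<tau>"
  proof (intro moebius_eqI)
    show "(1 - \<tau>) * (\<epsilon> * inverse b * \<epsilon> - 1) = \<epsilon> - \<epsilon> * inverse b" using P(6) bi eps(1) by algebra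
    show "\<epsilon> * inverse b * \<epsilon> - 1 \<noteq> 0" by (rule den) (simp add: roots)
  qed
  moreover have "moebius \<epsilon> (\<epsilon> ^ 2 * inverse b) = inverse (1 - inverse \<tau>)"
  proof (intro moebius_eqI)
    define i where "i = inverse (1 - inverse \<tau>)"
    have "(\<epsilon> - b * \<epsilon>) * i = b * \<epsilon>^2 - 1" using P(5) by (simp add: i_def)
    hence "i * (\<epsilon> ^ 2 * inverse b * \<epsilon> - 1) = \<epsilon> - \<epsilon> ^ 2 * inverse b" using bi eps(1) by algebra
    thus "inverse (1 - inverse \<tau>) * (\<epsilon> ^ 2 * inverse b * \<epsilon> - 1) = \<epsilon> - \<epsilon> ^ 2 * inverse b"
      by (simp add: i_def)
    show "\<epsilon> ^ 2 * inverse b * \<epsilon> - 1 \<noteq> 0" by (rule den) (simp add: roots)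
  qed
  moreover have "moebius \<epsilon> (- 1) = - 1"
    using den[of "- 1"] by (intro moebius_eqI) (simp_all add: roots)
  moreover have "moebius \<epsilon> (\<epsilon> * - 1) = 2"
  proof (intro moebius_eqI)
    show "2 * (\<epsilon> * - 1 * \<epsilon> - 1) = \<epsilon> - \<epsilon> * - 1" using cube_root_of_unity_sum[OF eps] by algebra
    show "\<epsilon> * - 1 * \<epsilon> - 1 \<noteq> 0" by (rule den) (simp add: roots)
  qed
  moreover have "moebius \<epsilon> (\<epsilon> ^ 2 * - 1) = 1 / 2"
  proof (intro moebius_eqI)
    have "\<epsilon> ^ 2 * \<epsilon> = 1" using eps(1) by algebra
    moreover have "\<epsilon> + \<epsilon> ^ 2 = - 1" using cube_root_of_unity_sum[OF eps] by algebra
    ultimately show "1 / 2 * (\<epsilon> ^ 2 * - 1 * \<epsilon> - 1) = \<epsilon> - \<epsilon> ^ 2 * - 1" by simp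
    show "\<epsilon> ^ 2 * - 1 * \<epsilon> - 1 \<noteq> 0" by (rule den) (simp add: roots)
  qed
  ultimately show ?thesis unfolding roots image_insert image_empty by (simp only:) blast
qed

end

section \<open>Counting the 36 cubics and their normal forms\<close>

theorem mainTheorem5:
  fixes \<epsilon> b \<tau> p :: complex
    and \<Lambda> :: "complex set"
    and f :: "complex \<Rightarrow> complex"
  assumes eps: "\<epsilon>^3 = 1" "\<epsilon> \<noteq> 1"
    and b: "b^3 = 2"
    and tau: "\<tau> = - \<epsilon> * ((b * \<epsilon>^2 - 1) / (b * \<epsilon> - 1))"
    and cover: "equianharmonic_cover \<Lambda> f"
    and origin: "ram_index f p = 3"
  shows "proj_torsion \<Lambda> f p 6 - proj_torsion \<Lambda> f p 3 =
       Some ` {\<tau>, inverse (1 - \<tau>), 1 - inverse \<tau>, inverse \<tau>,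
               inverse (1 - inverse \<tau>), 1 - \<tau>, -1, 1/2, 2} \<and>
     halphen_cubics \<epsilon> \<Lambda> f p 2 - halphen_cubics \<epsilon> \<Lambda> f p 1 =
       {plane_curve (pencil_member \<epsilon> t u) | t u.
          u \<in> proj_torsion \<Lambda> f p 6 - proj_torsion \<Lambda> f p 3} \<and>
     card (halphen_cubics \<epsilon> \<Lambda> f p 2 - halphen_cubics \<epsilon> \<Lambda> f p 1) = 36 \<and>
     proportional (pencil_member \<epsilon> Pencil_v (Some \<tau>))
       (\<lambda>x y z. (b - \<epsilon>) * x^3 + \<epsilon>^2 * (b - 1) * y^3 + (b * \<epsilon> - 1) * z^3) \<and>
     proportional (pencil_member \<epsilon> Pencil_h (Some \<tau>))
       (\<lambda>x y z. x^2 * y - \<epsilon>^2 * b * x * y^2 - \<epsilon>^2 * b * x^2 * z + y^2 * z + x * z^2 - \<epsilon>^2 * b * y * z^2) \<and>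
     proportional (pencil_member \<epsilon> Pencil_delta (Some \<tau>))
       (\<lambda>x y z. x^2 * y - b * x * y^2 - \<epsilon>^2 * b * x^2 * z + \<epsilon>^2 * y^2 * z + \<epsilon> * x * z^2 - \<epsilon> * b * y * z^2) \<and>
     proportional (pencil_member \<epsilon> Pencil_gamma (Some \<tau>))
       (\<lambda>x y z. x^2 * y - \<epsilon>^2 * b * x * y^2 - b * x^2 * z + \<epsilon> * y^2 * z + \<epsilon>^2 * x * z^2 - \<epsilon> * b * y * z^2) \<and>
     proportional (pencil_member \<epsilon> Pencil_v (Some (inverse (1 - \<tau>))))
       (\<lambda>x y z. \<epsilon> * (b * \<epsilon> - 1) * x^3 + \<epsilon> * (b - \<epsilon>) * y^3 + (b - 1) * z^3) \<and>
     proportional (pencil_member \<epsilon> Pencil_h (Some (inverse (1 - \<tau>))))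
       (\<lambda>x y z. x^2 * y - \<epsilon> * b * x * y^2 - \<epsilon> * b * x^2 * z + y^2 * z + x * z^2 - \<epsilon> * b * y * z^2) \<and>
     proportional (pencil_member \<epsilon> Pencil_delta (Some (inverse (1 - \<tau>))))
       (\<lambda>x y z. x^2 * y - \<epsilon>^2 * b * x * y^2 - \<epsilon> * b * x^2 * z + \<epsilon>^2 * y^2 * z + \<epsilon> * x * z^2 - b * y * z^2) \<and>
     proportional (pencil_member \<epsilon> Pencil_gamma (Some (inverse (1 - \<tau>))))
       (\<lambda>x y z. x^2 * y - \<epsilon> * b * x * y^2 - \<epsilon>^2 * b * x^2 * z + \<epsilon> * y^2 * z + \<epsilon>^2 * x * z^2 - b * y * z^2) \<and>
     proportional (pencil_member \<epsilon> Pencil_v (Some (1 - inverse \<tau>)))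
       (\<lambda>x y z. \<epsilon> * (b - 1) * x^3 + (b - \<epsilon>^2) * y^3 + (b * \<epsilon>^2 - 1) * z^3) \<and>
     proportional (pencil_member \<epsilon> Pencil_h (Some (1 - inverse \<tau>)))
       (\<lambda>x y z. x^2 * y - b * x * y^2 - b * x^2 * z + y^2 * z + x * z^2 - b * y * z^2) \<and>
     proportional (pencil_member \<epsilon> Pencil_delta (Some (1 - inverse \<tau>)))
       (\<lambda>x y z. x^2 * y - \<epsilon> * b * x * y^2 - b * x^2 * z + \<epsilon>^2 * y^2 * z + \<epsilon> * x * z^2 - \<epsilon>^2 * b * y * z^2) \<and>
     proportional (pencil_member \<epsilon> Pencil_gamma (Some (1 - inverse \<tau>)))
       (\<lambda>x y z. x^2 * y - b * x * y^2 - \<epsilon> * b * x^2 * z + \<epsilon> * y^2 * z + \<epsilon>^2 * x * z^2 - \<epsilon>^2 * b * y * z^2) \<and>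
     proportional (pencil_member \<epsilon> Pencil_v (Some (inverse \<tau>)))
       (\<lambda>x y z. (b - \<epsilon>^2) * x^3 + \<epsilon> * (b - 1) * y^3 + (b * \<epsilon>^2 - 1) * z^3) \<and>
     proportional (pencil_member \<epsilon> Pencil_h (Some (inverse \<tau>)))
       (\<lambda>x y z. 2 * x^2 * y - \<epsilon>^2 * b^2 * x * y^2 - \<epsilon>^2 * b^2 * x^2 * z + 2 * y^2 * z + 2 * x * z^2 - \<epsilon>^2 * b^2 * y * z^2) \<and>
     proportional (pencil_member \<epsilon> Pencil_delta (Some (inverse \<tau>)))
       (\<lambda>x y z. 2 * x^2 * y - b^2 * x * y^2 - \<epsilon>^2 * b^2 * x^2 * z + 2 * \<epsilon>^2 * y^2 * z + 2 * \<epsilon> * x * z^2 - \<epsilon> * b^2 * y * z^2) \<and>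
     proportional (pencil_member \<epsilon> Pencil_gamma (Some (inverse \<tau>)))
       (\<lambda>x y z. 2 * x^2 * y - \<epsilon>^2 * b^2 * x * y^2 - b^2 * x^2 * z + 2 * \<epsilon> * y^2 * z + 2 * \<epsilon>^2 * x * z^2 - \<epsilon> * b^2 * y * z^2) \<and>
     proportional (pencil_member \<epsilon> Pencil_v (Some (inverse (1 - inverse \<tau>))))
       (\<lambda>x y z. \<epsilon> * (b - \<epsilon>) * x^3 + \<epsilon> * (b * \<epsilon> - 1) * y^3 + (b - 1) * z^3) \<and>
     proportional (pencil_member \<epsilon> Pencil_h (Some (inverse (1 - inverse \<tau>))))
       (\<lambda>x y z. 2 * x^2 * y - \<epsilon> * b^2 * x * y^2 - \<epsilon> * b^2 * x^2 * z + 2 * y^2 * z + 2 * x * z^2 - \<epsilon> * b^2 * y * z^2) \<and>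
     proportional (pencil_member \<epsilon> Pencil_delta (Some (inverse (1 - inverse \<tau>))))
       (\<lambda>x y z. 2 * x^2 * y - \<epsilon>^2 * b^2 * x * y^2 - \<epsilon> * b^2 * x^2 * z + 2 * \<epsilon>^2 * y^2 * z + 2 * \<epsilon> * x * z^2 - b^2 * y * z^2) \<and>
     proportional (pencil_member \<epsilon> Pencil_gamma (Some (inverse (1 - inverse \<tau>))))
       (\<lambda>x y z. 2 * x^2 * y - \<epsilon> * b^2 * x * y^2 - \<epsilon>^2 * b^2 * x^2 * z + 2 * \<epsilon> * y^2 * z + 2 * \<epsilon>^2 * x * z^2 - b^2 * y * z^2) \<and>
     proportional (pencil_member \<epsilon> Pencil_v (Some (1 - \<tau>)))
       (\<lambda>x y z. \<epsilon>^2 * (b - 1) * x^3 + (b - \<epsilon>) * y^3 + (b * \<epsilon> - 1) * z^3) \<and>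
     proportional (pencil_member \<epsilon> Pencil_h (Some (1 - \<tau>)))
       (\<lambda>x y z. 2 * x^2 * y - b^2 * x * y^2 - b^2 * x^2 * z + 2 * y^2 * z + 2 * x * z^2 - b^2 * y * z^2) \<and>
     proportional (pencil_member \<epsilon> Pencil_delta (Some (1 - \<tau>)))
       (\<lambda>x y z. 2 * x^2 * y - \<epsilon> * b^2 * x * y^2 - b^2 * x^2 * z + 2 * \<epsilon>^2 * y^2 * z + 2 * \<epsilon> * x * z^2 - \<epsilon>^2 * b^2 * y * z^2) \<and>
     proportional (pencil_member \<epsilon> Pencil_gamma (Some (1 - \<tau>)))
       (\<lambda>x y z. 2 * x^2 * y - b^2 * x * y^2 - \<epsilon> * b^2 * x^2 * z + 2 * \<epsilon> * y^2 * z + 2 * \<epsilon>^2 * x * z^2 - \<epsilon>^2 * b^2 * y * z^2) \<and>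
     proportional (pencil_member \<epsilon> Pencil_v (Some (-1)))
       (\<lambda>x y z. x^3 - 2 * y^3 + z^3) \<and>
     proportional (pencil_member \<epsilon> Pencil_h (Some (-1)))
       (\<lambda>x y z. x^2 * y + \<epsilon>^2 * x * y^2 + \<epsilon>^2 * x^2 * z + y^2 * z + x * z^2 + \<epsilon>^2 * y * z^2) \<and>
     proportional (pencil_member \<epsilon> Pencil_delta (Some (-1)))
       (\<lambda>x y z. x^2 * y + x * y^2 + \<epsilon>^2 * x^2 * z + \<epsilon>^2 * y^2 * z + \<epsilon> * x * z^2 + \<epsilon> * y * z^2) \<and>
     proportional (pencil_member \<epsilon> Pencil_gamma (Some (-1)))
       (\<lambda>x y z. x^2 * y + \<epsilon>^2 * x * y^2 + x^2 * z + \<epsilon> * y^2 * z + \<epsilon>^2 * x * z^2 + \<epsilon> * y * z^2) \<and>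
     proportional (pencil_member \<epsilon> Pencil_v (Some (1/2)))
       (\<lambda>x y z. x^3 + y^3 - 2 * z^3) \<and>
     proportional (pencil_member \<epsilon> Pencil_h (Some (1/2)))
       (\<lambda>x y z. x^2 * y + \<epsilon> * x * y^2 + \<epsilon> * x^2 * z + y^2 * z + x * z^2 + \<epsilon> * y * z^2) \<and>
     proportional (pencil_member \<epsilon> Pencil_delta (Some (1/2)))
       (\<lambda>x y z. x^2 * y + \<epsilon>^2 * x * y^2 + \<epsilon> * x^2 * z + \<epsilon>^2 * y^2 * z + \<epsilon> * x * z^2 + y * z^2) \<and>
     proportional (pencil_member \<epsilon> Pencil_gamma (Some (1/2)))
       (\<lambda>x y z. x^2 * y + \<epsilon> * x * y^2 + \<epsilon>^2 * x^2 * z + \<epsilon> * y^2 * z + \<epsilon>^2 * x * z^2 + y * z^2) \<and>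
     proportional (pencil_member \<epsilon> Pencil_v (Some 2))
       (\<lambda>x y z. 2 * x^3 - y^3 - z^3) \<and>
     proportional (pencil_member \<epsilon> Pencil_h (Some 2))
       (\<lambda>x y z. x^2 * y + x * y^2 + x^2 * z + y^2 * z + x * z^2 + y * z^2) \<and>
     proportional (pencil_member \<epsilon> Pencil_delta (Some 2))
       (\<lambda>x y z. x^2 * y + \<epsilon> * x * y^2 + x^2 * z + \<epsilon>^2 * y^2 * z + \<epsilon> * x * z^2 + \<epsilon>^2 * y * z^2) \<and>
     proportional (pencil_member \<epsilon> Pencil_gamma (Some 2))
       (\<lambda>x y z. x^2 * y + x * y^2 + \<epsilon> * x^2 * z + \<epsilon> * y^2 * z + \<epsilon>^2 * x * z^2 + \<epsilon>^2 * y * z^2)"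
proof -
  interpret equianharmonic \<Lambda> f by unfold_locales (rule cover)
  obtain q where "proj_value f q = None" using surj_proj_value by blast
  hence q: "is_pole f q" by (auto simp: proj_value_def split: if_splits)
  note P = six_parameter_products[OF eps b tau]
  let ?T = "proj_torsion \<Lambda> f p 6 - proj_torsion \<Lambda> f p 3"
  let ?V = "moebius \<epsilon> ` binomial_roots"
  have T: "?T = Some ` ?V"
    unfolding proj_torsion_3[OF q eps origin] proj_torsion_6[OF q eps origin]
      six_torsion_values[OF eps, symmetric] by (rule image_set_diff[symmetric]) simp
  \<comment> \<open>A cubic determines its pencil and its parameter. Hence removing the cubics of
    order 1 amounts to removing their parameters, and the curves number 4 * 9.\<close>
  define C where "C = (\<lambda>(t, u). plane_curve (pencil_member \<epsilon> t (Some u)))"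
  have inj: "inj C"
    using plane_curve_member_inject[OF eps] by (auto simp: inj_def C_def)
  have halphen: "halphen_cubics \<epsilon> \<Lambda> f p m = C ` (UNIV \<times> U)"
    if "proj_torsion \<Lambda> f p (3 * m) = Some ` U" for m U
    unfolding halphen_cubics_def that C_def by auto
  have curves: "{plane_curve (pencil_member \<epsilon> t u) | t u. u \<in> Some ` U} = C ` (UNIV \<times> U)" for U
    unfolding C_def by auto
  have diff: "halphen_cubics \<epsilon> \<Lambda> f p 2 - halphen_cubics \<epsilon> \<Lambda> f p 1 = C ` (UNIV \<times> ?V)"
  proof -
    let ?U = "{u. u \<noteq> 0 \<and> u \<noteq> 1 \<and> (2 * u = 1 \<or> doubling u \<in> {0, 1, - \<epsilon>, - (\<epsilon> ^ 2)})}"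
    have "halphen_cubics \<epsilon> \<Lambda> f p 2 = C ` (UNIV \<times> ?U)"
      by (rule halphen) (use proj_torsion_6[OF q eps origin] in simp)
    moreover have "halphen_cubics \<epsilon> \<Lambda> f p 1 = C ` (UNIV \<times> {- \<epsilon>, - (\<epsilon> ^ 2)})"
      by (rule halphen) (use proj_torsion_3[OF q eps origin] in simp)
    ultimately have "halphen_cubics \<epsilon> \<Lambda> f p 2 - halphen_cubics \<epsilon> \<Lambda> f p 1 =
        C ` (UNIV \<times> ?U - UNIV \<times> {- \<epsilon>, - (\<epsilon> ^ 2)})"
      by (simp only: image_set_diff[OF inj])
    also have "UNIV \<times> ?U - UNIV \<times> {- \<epsilon>, - (\<epsilon> ^ 2)} = UNIV \<times> (?U - {- \<epsilon>, - (\<epsilon> ^ 2)})" by blast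
    finally show ?thesis unfolding six_torsion_values[OF eps] .
  qed
  have card: "card (C ` (UNIV \<times> ?V)) = 36"
    using inj by (subst card_image)
      (auto intro: inj_on_subset simp: card_cartesian_product card_pencil card_image[OF inj_on_moebius[OF eps]] card_binomial_roots)
  have b_rules: "b * (b * b) = 2" "b * (b * (b * X)) = 2 * X" for X
    using b by (simp_all add: power3_eq_cube flip: mult.assoc)
  \<comment> \<open>Coefficients are reduced modulo \<epsilon>^2 + \<epsilon> + 1 and b^3 -
    2.\<close>
  note normal_form = eps_rules[OF eps] b_rules algebra_simps power2_eq_square power3_eq_cube
  \<comment> \<open>For the pencils h, \<delta> and \<gamma> the factor is the coefficient - (d +
    \<epsilon> * n) of x^2 y, the same in all three; the target cubic has 1 there, or 2 when s = 2.
    For v it is the ratio of the coefficients of z^3.\<close>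
  have scale: "1 \<noteq> (0::complex)" "2 + \<epsilon> \<noteq> 0" "- \<epsilon> \<noteq> 0" "b * (2 + \<epsilon>) \<noteq> 0" "b * (\<epsilon> - 1) \<noteq> 0"
    "- (b * (1 + 2 * \<epsilon>)) \<noteq> 0" "\<epsilon> - 1 \<noteq> 0" "- 1 \<noteq> (0::complex)" "- (2 + \<epsilon>) \<noteq> 0" "- (1 + 2 * \<epsilon>) \<noteq> 0"
  proof -
    have "(1 + 2 * \<epsilon>) ^ 2 = - 3" "(2 + \<epsilon>) * (1 - \<epsilon>) = 3"
      using cube_root_of_unity_sum[OF eps] by algebra+
    hence "1 + 2 * \<epsilon> \<noteq> 0" "2 + \<epsilon> \<noteq> 0" by auto
    moreover have "\<epsilon> \<noteq> 0" "b \<noteq> 0" using eps b by auto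
    ultimately show "1 \<noteq> (0::complex)" "2 + \<epsilon> \<noteq> 0" "- \<epsilon> \<noteq> 0" "b * (2 + \<epsilon>) \<noteq> 0" "b * (\<epsilon> - 1) \<noteq> 0"
      "- (b * (1 + 2 * \<epsilon>)) \<noteq> 0" "\<epsilon> - 1 \<noteq> 0" "- 1 \<noteq> (0::complex)" "- (2 + \<epsilon>) \<noteq> 0" "- (1 + 2 * \<epsilon>) \<noteq> 0"
      using eps(2) unfolding neg_equal_0_iff_equal by simp_all
  qed
  show ?thesis
    \<comment> \<open>In the cases of the single cubics the member of \<open>scale\<close> that is cited supplies the factor \<open>k\<close>.\<close>
  proof (intro conjI, goal_cases)
    case 1
    show ?case unfolding T nine_values[OF eps b tau] ..
  next
    case 2
    show ?case unfolding diff T curves ..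
  next
    case 3
    show ?case unfolding diff by (rule card)
  next
    case 4
    show ?case
      by (rule proportional_memberI[OF P(1) P(7) _ scale(1), where s = 1])
         (simp_all add: normal_form)
  next
    case 5
    show ?case
      by (rule proportional_memberI[OF P(1) P(7) _ scale(2), where s = 1])
         (simp_all add: normal_form)
  next
    case 6
    show ?case
      by (rule proportional_memberI[OF P(1) P(7) _ scale(2), where s = 1])
         (simp_all add: normal_form)
  next
    case 7
    show ?case
      by (rule proportional_memberI[OF P(1) P(7) _ scale(2), where s = 1])
         (simp_all add: normal_form)
  next
    case 8
    show ?case
      by (rule proportional_memberI[OF P(2) P(8) _ scale(1), where s = 1])
         (simp_all add: normal_form)
  next
    case 9
    show ?case
      by (rule proportional_memberI[OF P(2) P(8) _ scale(2), where s = 1])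
         (simp_all add: normal_form)
  next
    case 10
    show ?case
      by (rule proportional_memberI[OF P(2) P(8) _ scale(2), where s = 1])
         (simp_all add: normal_form)
  next
    case 11
    show ?case
      by (rule proportional_memberI[OF P(2) P(8) _ scale(2), where s = 1])
         (simp_all add: normal_form)
  next
    case 12
    show ?case
      by (rule proportional_memberI[OF P(3) P(9) _ scale(1), where s = 1])
         (simp_all add: normal_form)
  next
    case 13
    show ?case
      by (rule proportional_memberI[OF P(3) P(9) _ scale(2), where s = 1])
         (simp_all add: normal_form)
  next
    case 14
    show ?case
      by (rule proportional_memberI[OF P(3) P(9) _ scale(2), where s = 1])
         (simp_all add: normal_form)
  next
    case 15
    show ?case
      by (rule proportional_memberI[OF P(3) P(9) _ scale(2), where s = 1])
         (simp_all add: normal_form)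
  next
    case 16
    show ?case
      by (rule proportional_memberI[OF P(4) P(10) _ scale(3), where s = 1])
         (simp_all add: normal_form)
  next
    case 17
    show ?case
      by (rule proportional_memberI[OF P(4) P(10) _ scale(4), where s = 2])
         (simp_all add: normal_form)
  next
    case 18
    show ?case
      by (rule proportional_memberI[OF P(4) P(10) _ scale(4), where s = 2])
         (simp_all add: normal_form)
  next
    case 19
    show ?case
      by (rule proportional_memberI[OF P(4) P(10) _ scale(4), where s = 2])
         (simp_all add: normal_form)
  next
    case 20
    show ?case
      by (rule proportional_memberI[OF P(5) P(11) _ scale(3), where s = 1])
         (simp_all add: normal_form)
  next
    case 21
    show ?case
      by (rule proportional_memberI[OF P(5) P(11) _ scale(5), where s = 2])
         (simp_all add: normal_form)
  next
    case 22
    show ?case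
      by (rule proportional_memberI[OF P(5) P(11) _ scale(5), where s = 2])
         (simp_all add: normal_form)
  next
    case 23
    show ?case
      by (rule proportional_memberI[OF P(5) P(11) _ scale(5), where s = 2])
         (simp_all add: normal_form)
  next
    case 24
    show ?case
      by (rule proportional_memberI[OF P(6) P(12) _ scale(3), where s = 1])
         (simp_all add: normal_form)
  next
    case 25
    show ?case
      by (rule proportional_memberI[OF P(6) P(12) _ scale(6), where s = 2])
         (simp_all add: normal_form)
  next
    case 26
    show ?case
      by (rule proportional_memberI[OF P(6) P(12) _ scale(6), where s = 2])
         (simp_all add: normal_form)
  next
    case 27
    show ?case
      by (rule proportional_memberI[OF P(6) P(12) _ scale(6), where s = 2])
         (simp_all add: normal_form)
  next
    case 28
    show ?case
      by (rule proportional_memberI[OF _ _ _ scale(1), where d = "1" and n = "- 1" and s = 1])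
         (simp_all add: normal_form)
  next
    case 29
    show ?case
      by (rule proportional_memberI[OF _ _ _ scale(7), where d = "1" and n = "- 1" and s = 1])
         (simp_all add: normal_form)
  next
    case 30
    show ?case
      by (rule proportional_memberI[OF _ _ _ scale(7), where d = "1" and n = "- 1" and s = 1])
         (simp_all add: normal_form)
  next
    case 31
    show ?case
      by (rule proportional_memberI[OF _ _ _ scale(7), where d = "1" and n = "- 1" and s = 1])
         (simp_all add: normal_form)
  next
    case 32
    show ?case
      by (rule proportional_memberI[OF _ _ _ scale(8), where d = "2" and n = "1" and s = 1])
         (simp_all add: normal_form)
  next
    case 33
    show ?case
      by (rule proportional_memberI[OF _ _ _ scale(9), where d = "2" and n = "1" and s = 1])
         (simp_all add: normal_form)
  next
    case 34
    show ?case
      by (rule proportional_memberI[OF _ _ _ scale(9), where d = "2" and n = "1" and s = 1])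
         (simp_all add: normal_form)
  next
    case 35
    show ?case
      by (rule proportional_memberI[OF _ _ _ scale(9), where d = "2" and n = "1" and s = 1])
         (simp_all add: normal_form)
  next
    case 36
    show ?case
      by (rule proportional_memberI[OF _ _ _ scale(8), where d = "1" and n = "2" and s = 1])
         (simp_all add: normal_form)
  next
    case 37
    show ?case
      by (rule proportional_memberI[OF _ _ _ scale(10), where d = "1" and n = "2" and s = 1])
         (simp_all add: normal_form)
  next
    case 38
    show ?case
      by (rule proportional_memberI[OF _ _ _ scale(10), where d = "1" and n = "2" and s = 1])
         (simp_all add: normal_form)
  next
    case 39
    show ?case
      by (rule proportional_memberI[OF _ _ _ scale(10), where d = "1" and n = "2" and s = 1])
         (simp_all add: normal_form)
  qed
qed

end
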